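(* Let $\mathcal E$ denote a cyclic six-term exact sequence of abelian groups $$G_1 \xrightarrow{\ \epsilon\ } G_2 \xrightarrow{\ \gamma\ } G_3 \xrightarrow{\ 0\ } F_1 \xrightarrow{\ \epsilon'\ } F_2 \xrightarrow{\ \gamma'\ } F_3 \xrightarrow{\ \delta\ } G_1$$ with $F_1,F_2,F_3$ free. Suppose that there exist column-finite matrices $A\in M_{n_1,n_1'}(\mathbb Z)$ and $B\in M_{n_3,n_3'}(\mathbb Z)$ for some $n_1,n_1',n_3,n_3'\in\{0,1,2,\ldots,\infty\}$, with isomorphisms $$\alpha_1:\operatorname{coker}A\to G_1,\quad \beta_1:\ker A\to F_1,\quad \alpha_3:\operatorname{coker}B\to G_3,\quad \beta_3:\ker B\to F_3.$$ Then there exist a column-finite matrix $Y\in M_{n_1,n_3'}(\mathbb Z)$ and isomorphisms $$\alpha_2:\operatorname{coker}\begin{pmatrix}A&Y\\0&B\end{pmatrix}\to G_2,\qquad \beta_2:\ker\begin{pmatrix}A&Y\\0&B\end{pmatrix}\to F_2$$ such that $\alpha_i$ and $\beta_i$, $i=1,2,3$, give an isomorphism of cyclic six-term exact sequences (i.e. all resulting squares commute) from $$\operatorname{coker}A\xrightarrow{I}\operatorname{coker}\begin{pmatrix}A&Y\\0&B\end{pmatrix}\xrightarrow{P}\operatorname{coker}B\xrightarrow{0}\ker A\xrightarrow{I'}\ker\begin{pmatrix}A&Y\\0&B\end{pmatrix}\xrightarrow{P'}\ker B\xrightarrow{[Y]}\operatorname{coker}A$$ to $\mathcal E$, where $I,I'$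 and $P,P'$ are induced by the obvious inclusions $x\mapsto(x,0)$ and projections $(x,y)\mapsto y$.
   Context: For $n\in\{0,1,2,\dots\}$, $\mathbb Z^n$ is the free abelian group on $n$ generators, and $\mathbb Z^\infty$ is the direct sum of countably infinitely many copies of $\mathbb Z$. $M_{m,n}(\mathbb Z)$ is the set of $m\times n$ integer matrices that are column-finite (each column has only finitely many nonzero entries); such a matrix is identified with the homomorphism $\mathbb Z^n\to\mathbb Z^m$ it defines. $\begin{pmatrix}A&Y\\0&B\end{pmatrix}$ is viewed as a map $\mathbb Z^{n_1'}\oplus\mathbb Z^{n_3'}\to\mathbb Z^{n_1}\oplus\mathbb Z^{n_3}$. $[Y]$ is the composition of the restriction of $Y$ to $\ker B$ with the quotient map $\mathbb Z^{n_1}\to\operatorname{coker}A$. *)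

theory Defs
  imports "HOL-Algebra.Free_Abelian_Groups" "HOL-Library.Extended_Nat"
begin

section \<open>Groups, kernels and cokernels\<close>

text \<open>
  Abelian groups are written multiplicatively, as in HOL-Algebra. If a basis exists at all, it can
  be chosen as a subset of the group, so indexing it by a set of the same type loses no generality.
\<close>

definition free_abelian :: "'a monoid \<Rightarrow> bool" where
  "free_abelian G \<longleftrightarrow> (\<exists>S :: 'a set. G \<cong> free_Abelian_group S)"

definition ker_group :: "'a monoid \<Rightarrow> 'b monoid \<Rightarrow> ('a \<Rightarrow> 'b) \<Rightarrow> 'a monoid" where
  "ker_group G H h = G\<lparr>carrier := kernel G H h\<rparr>"

definition coker_group :: "'a monoid \<Rightarrow> 'b monoid \<Rightarrow> ('a \<Rightarrow> 'b) \<Rightarrow> 'b set monoid" where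
  "coker_group G H h = H Mod (h ` carrier G)"

definition coker_proj :: "'a monoid \<Rightarrow> 'b monoid \<Rightarrow> ('a \<Rightarrow> 'b) \<Rightarrow> 'b \<Rightarrow> 'b set" where
  "coker_proj G H h x = (h ` carrier G) #>\<^bsub>H\<^esub> x"

text \<open>
  The map from a quotient group induced by \<open>\<phi>\<close>, where \<open>q\<close> is the projection onto the target
  quotient. The argument \<open>C\<close> is a coset; when the induced map is well defined, all \<open>x \<in> C\<close> give the
  same coset \<open>q (\<phi> x)\<close>, and the union is that coset.
\<close>

definition induced_map :: "('c \<Rightarrow> 'd set) \<Rightarrow> ('b \<Rightarrow> 'c) \<Rightarrow> 'b set \<Rightarrow> 'd set" where
  "induced_map q \<phi> C = (\<Union>x\<in>C. q (\<phi> x))"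


section \<open>Cyclic six-term exact sequences\<close>

text \<open>
  \<open>SixTerm G1 f1 G2 f2 G3 f3 G4 f4 G5 f5 G6 f6\<close> is the cyclic diagram
  \<open>G1 \<rightarrow> G2 \<rightarrow> G3 \<rightarrow> G4 \<rightarrow> G5 \<rightarrow> G6 \<rightarrow> G1\<close>, each map standing after its domain.
\<close>

datatype ('a, 'b, 'c, 'd, 'e, 'f) six_term =
  SixTerm "'a monoid" "'a \<Rightarrow> 'b" "'b monoid" "'b \<Rightarrow> 'c" "'c monoid" "'c \<Rightarrow> 'd"
          "'d monoid" "'d \<Rightarrow> 'e" "'e monoid" "'e \<Rightarrow> 'f" "'f monoid" "'f \<Rightarrow> 'a"

fun exact_six_term :: "('a, 'b, 'c, 'd, 'e, 'f) six_term \<Rightarrow> bool" where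
  "exact_six_term (SixTerm G1 f1 G2 f2 G3 f3 G4 f4 G5 f5 G6 f6) \<longleftrightarrow>
     comm_group G1 \<and> comm_group G2 \<and> comm_group G3 \<and>
     comm_group G4 \<and> comm_group G5 \<and> comm_group G6 \<and>
     f1 \<in> hom G1 G2 \<and> f2 \<in> hom G2 G3 \<and> f3 \<in> hom G3 G4 \<and>
     f4 \<in> hom G4 G5 \<and> f5 \<in> hom G5 G6 \<and> f6 \<in> hom G6 G1 \<and>
     f1 ` carrier G1 = kernel G2 G3 f2 \<and>
     f2 ` carrier G2 = kernel G3 G4 f3 \<and>
     f3 ` carrier G3 = kernel G4 G5 f4 \<and>
     f4 ` carrier G4 = kernel G5 G6 f5 \<and>
     f5 ` carrier G5 = kernel G6 G1 f6 \<and>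
     f6 ` carrier G6 = kernel G1 G2 f1"

fun six_term_iso :: "('a1, 'a2, 'a3, 'a4, 'a5, 'a6) six_term \<Rightarrow>
    ('b1, 'b2, 'b3, 'b4, 'b5, 'b6) six_term \<Rightarrow>
    ('a1 \<Rightarrow> 'b1) \<Rightarrow> ('a2 \<Rightarrow> 'b2) \<Rightarrow> ('a3 \<Rightarrow> 'b3) \<Rightarrow>
    ('a4 \<Rightarrow> 'b4) \<Rightarrow> ('a5 \<Rightarrow> 'b5) \<Rightarrow> ('a6 \<Rightarrow> 'b6) \<Rightarrow> bool" where
  "six_term_iso (SixTerm G1 f1 G2 f2 G3 f3 G4 f4 G5 f5 G6 f6)
                (SixTerm H1 g1 H2 g2 H3 g3 H4 g4 H5 g5 H6 g6) h1 h2 h3 h4 h5 h6 \<longleftrightarrow>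
     h1 \<in> iso G1 H1 \<and> h2 \<in> iso G2 H2 \<and> h3 \<in> iso G3 H3 \<and>
     h4 \<in> iso G4 H4 \<and> h5 \<in> iso G5 H5 \<and> h6 \<in> iso G6 H6 \<and>
     (\<forall>x\<in>carrier G1. h2 (f1 x) = g1 (h1 x)) \<and>
     (\<forall>x\<in>carrier G2. h3 (f2 x) = g2 (h2 x)) \<and>
     (\<forall>x\<in>carrier G3. h4 (f3 x) = g3 (h3 x)) \<and>
     (\<forall>x\<in>carrier G4. h5 (f4 x) = g4 (h4 x)) \<and>
     (\<forall>x\<in>carrier G5. h6 (f5 x) = g5 (h5 x)) \<and>
     (\<forall>x\<in>carrier G6. h1 (f6 x) = g6 (h6 x))"


section \<open>Column-finite integer matrices\<close>

text \<open>
  The free abelian group on \<open>n\<close> generators, \<open>n \<in> {0, 1, 2, \<dots>, \<infinity>}\<close>, consists of the finitely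
  supported integer-valued functions on \<open>{i. i < n}\<close>.
\<close>

definition Zpow :: "enat \<Rightarrow> (nat \<Rightarrow>\<^sub>0 int) monoid" where
  "Zpow n = free_Abelian_group {i. enat i < n}"

text \<open>
  Matrices of a given size are represented by functions vanishing outside the index range, so that
  the representation is unique.
\<close>

definition col_finite_mats :: "enat \<Rightarrow> enat \<Rightarrow> (nat \<Rightarrow> nat \<Rightarrow> int) set" where
  "col_finite_mats m n =
     {A. (\<forall>i j. A i j \<noteq> 0 \<longrightarrow> enat i < m \<and> enat j < n) \<and> (\<forall>j. finite {i. A i j \<noteq> 0})}"

text \<open>
  The homomorphism defined by a column-finite matrix sends the \<open>j\<close>-th generator to the \<open>j\<close>-th
  column.
\<close>

definition mat_hom :: "(nat \<Rightarrow> nat \<Rightarrow> int) \<Rightarrow> (nat \<Rightarrow>\<^sub>0 int) \<Rightarrow> (nat \<Rightarrow>\<^sub>0 int)" where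
  "mat_hom A = frag_extend (\<lambda>j. Abs_poly_mapping (\<lambda>i. A i j))"

definition block_hom :: "(nat \<Rightarrow> nat \<Rightarrow> int) \<Rightarrow> (nat \<Rightarrow> nat \<Rightarrow> int) \<Rightarrow>
    (nat \<Rightarrow> nat \<Rightarrow> int) \<Rightarrow> (nat \<Rightarrow> nat \<Rightarrow> int) \<Rightarrow>
    (nat \<Rightarrow>\<^sub>0 int) \<times> (nat \<Rightarrow>\<^sub>0 int) \<Rightarrow> (nat \<Rightarrow>\<^sub>0 int) \<times> (nat \<Rightarrow>\<^sub>0 int)" where
  "block_hom A Y C B = (\<lambda>(x, y). (mat_hom A x + mat_hom Y y, mat_hom C x + mat_hom B y))"

abbreviation mat_ker :: "enat \<Rightarrow> enat \<Rightarrow> (nat \<Rightarrow> nat \<Rightarrow> int) \<Rightarrow> (nat \<Rightarrow>\<^sub>0 int) monoid" where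
  "mat_ker m n A \<equiv> ker_group (Zpow n) (Zpow m) (mat_hom A)"

abbreviation mat_coker :: "enat \<Rightarrow> enat \<Rightarrow> (nat \<Rightarrow> nat \<Rightarrow> int) \<Rightarrow> (nat \<Rightarrow>\<^sub>0 int) set monoid" where
  "mat_coker m n A \<equiv> coker_group (Zpow n) (Zpow m) (mat_hom A)"

abbreviation mat_coker_proj ::
    "enat \<Rightarrow> enat \<Rightarrow> (nat \<Rightarrow> nat \<Rightarrow> int) \<Rightarrow> (nat \<Rightarrow>\<^sub>0 int) \<Rightarrow> (nat \<Rightarrow>\<^sub>0 int) set" where
  "mat_coker_proj m n A \<equiv> coker_proj (Zpow n) (Zpow m) (mat_hom A)"

text \<open>
  The sequence of the block matrix \<open>(A Y; 0 B)\<close>, with \<open>A\<close> of size \<open>n1 \<times> n1'\<close> and \<open>B\<close> of size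
  \<open>n3 \<times> n3'\<close>:
  \<open>coker A \<rightarrow> coker (A Y; 0 B) \<rightarrow> coker B \<rightarrow> ker A \<rightarrow> ker (A Y; 0 B) \<rightarrow> ker B \<rightarrow> coker A\<close>.
\<close>

definition block_six_term :: "enat \<Rightarrow> enat \<Rightarrow> enat \<Rightarrow> enat \<Rightarrow>
    (nat \<Rightarrow> nat \<Rightarrow> int) \<Rightarrow> (nat \<Rightarrow> nat \<Rightarrow> int) \<Rightarrow> (nat \<Rightarrow> nat \<Rightarrow> int) \<Rightarrow>
    ((nat \<Rightarrow>\<^sub>0 int) set, ((nat \<Rightarrow>\<^sub>0 int) \<times> (nat \<Rightarrow>\<^sub>0 int)) set, (nat \<Rightarrow>\<^sub>0 int) set,
     nat \<Rightarrow>\<^sub>0 int, (nat \<Rightarrow>\<^sub>0 int) \<times> (nat \<Rightarrow>\<^sub>0 int), nat \<Rightarrow>\<^sub>0 int) six_term" where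
  "block_six_term n1 n1' n3 n3' A Y B =
     (let D = Zpow n1' \<times>\<times> Zpow n3'; R = Zpow n1 \<times>\<times> Zpow n3;
          M = block_hom A Y (\<lambda>_ _. 0) B
      in SixTerm
           (mat_coker n1 n1' A) (induced_map (coker_proj D R M) (\<lambda>x. (x, 0)))
           (coker_group D R M) (induced_map (mat_coker_proj n3 n3' B) snd)
           (mat_coker n3 n3' B) (\<lambda>_. 0)
           (mat_ker n1 n1' A) (\<lambda>x. (x, 0))
           (ker_group D R M) snd
           (mat_ker n3 n3' B) (\<lambda>y. mat_coker_proj n1 n1' A (mat_hom Y y)))"

end

theory Submission
  imports Defs
begin

text \<open>
  In additive notation, choose presentations \<open>p1\<close> of \<open>G1\<close> and \<open>p3\<close> of \<open>G3\<close> from the given isomorphisms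
  \<open>\<alpha>1\<close>, \<open>\<alpha>3\<close>, and lift \<open>p3\<close> through \<open>\<gamma>\<close> to a homomorphism \<open>s\<close> into \<open>G2\<close>. The matrix \<open>Y\<close> has to satisfy two
  conditions: \<open>p1 (Y y) = \<delta> (\<beta>3 y)\<close> for \<open>y\<close> in \<open>ker B\<close>, so that \<open>[Y]\<close> becomes the connecting map, and
  \<open>\<epsilon> (p1 (Y y)) = - s (B y)\<close> for all \<open>y\<close>, so that \<open>(x, z) \<mapsto> \<epsilon> (p1 x) + s z\<close> kills the columns of
  the block matrix. On \<open>ker B\<close> the first condition implies the second, as \<open>\<epsilon> \<circ> \<delta> = 0\<close>. Because the
  image of \<open>B\<close> is free, \<open>ker B\<close> is a direct summand; the first condition prescribes the solution
  there, and any solution of the second one serves on a complement (\<open>hom_Zpow_extend_lift\<close>).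

  Given such a \<open>Y\<close>, the map \<open>(x, z) \<mapsto> \<epsilon> (p1 x) + s z\<close> is a presentation of \<open>G2\<close> whose relations are
  generated by the columns of the block matrix (\<open>block_coker_presentation\<close>); this is \<open>\<alpha>2\<close>. On the side of
  the kernels, \<open>ker (A Y; 0 B)\<close> and \<open>F2\<close> are both split extensions of \<open>{y \<in> ker B. Y y \<in> im A}\<close>
  by \<open>ker A \<cong> F1\<close>, since this subgroup of a free group is free (\<open>block_kernel_iso\<close>); this is \<open>\<beta>2\<close>.
  Exactness of the sequence of the block matrix is then inherited from \<open>\<E>\<close>
  (\<open>exact_six_term_transport\<close>).

  All splittings rest on one fact: subgroups of free abelian groups are free, hence projective
  (\<open>subgroup_of_free_Abelian_group_projective\<close>). It is proved for a well-ordered basis.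
\<close>

section \<open>Subgroups of free abelian groups\<close>

lemma diff_in_subgroup:
  assumes S: "subgroup S (free_Abelian_group I)" and "x \<in> S" "y \<in> S"
  shows "x - y \<in> S"
  using subgroup.m_closed [OF S \<open>x \<in> S\<close> subgroup.m_inv_closed [OF S \<open>y \<in> S\<close>]]
    subgroup.mem_carrier [OF S \<open>y \<in> S\<close>] by simp

lemma frag_cmul_in_subgroup:
  assumes S: "subgroup S (free_Abelian_group I)" and c: "c \<in> S"
  shows "frag_cmul k c \<in> S"
proof (rule frag_closure_minus_cmul)
  show "0 \<in> S"
    using subgroup.one_closed [OF S] by simp
  show "x - y \<in> S" if "x \<in> S" "y \<in> S" for x y
    using that by (rule diff_in_subgroup [OF S])
qed (rule c)

text \<open>
  A nonzero element of least absolute value divides every other one, because the remainder of the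
  division lies in the ideal again and is smaller.
\<close>

lemma int_ideal_principal:
  fixes J :: "int set"
  assumes "0 \<in> J" and diff: "\<And>x y. \<lbrakk>x \<in> J; y \<in> J\<rbrakk> \<Longrightarrow> x - y \<in> J"
    and mult: "\<And>k x. x \<in> J \<Longrightarrow> k * x \<in> J"
  shows "\<exists>d\<in>J. \<forall>x\<in>J. d dvd x"
proof (cases "J = {0}")
  case True
  then show ?thesis
    by simp
next
  case False
  then obtain a where "a \<in> J \<and> a \<noteq> 0"
    using \<open>0 \<in> J\<close> by blast
  then obtain d where d: "d \<in> J" "d \<noteq> 0"
    and least: "\<And>y. y \<in> J \<and> y \<noteq> 0 \<Longrightarrow> nat \<bar>d\<bar> \<le> nat \<bar>y\<bar>"
    using ex_has_least_nat [of "\<lambda>x. x \<in> J \<and> x \<noteq> 0" a "\<lambda>x. nat \<bar>x\<bar>"] by blast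
  have "d dvd x" if "x \<in> J" for x
  proof (rule ccontr)
    assume "\<not> d dvd x"
    then have "x mod d \<noteq> 0"
      by (simp add: dvd_eq_mod_eq_0)
    moreover have "x mod d \<in> J"
      using diff [OF that mult [OF d(1)], of "x div d"] by (simp add: minus_div_mult_eq_mod)
    ultimately have "nat \<bar>d\<bar> \<le> nat \<bar>x mod d\<bar>"
      using least by blast
    then show False
      using abs_mod_less [OF d(2), of x] by linarith
  qed
  with d(1) show ?thesis
    by blast
qed

text \<open>
  Well-order the basis and look at leading coefficients. For each index \<open>k\<close>, the coefficients at \<open>k\<close>
  of the elements of \<open>S\<close> supported on \<open>{..k}\<close> form an ideal of the integers; let \<open>v k\<close> be an element
  that realises a generator of this ideal. The \<open>v k\<close> with nonzero leading coefficient form a basis of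
  \<open>S\<close>: they are in triangular form, hence independent, and subtracting a suitable multiple of \<open>v k\<close>
  strictly lowers the leading index of an element of \<open>S\<close>, so that by well-foundedness every element
  is reached in finitely many steps.
\<close>

theorem subgroup_of_free_Abelian_group_free:
  fixes S :: "('i::wellorder \<Rightarrow>\<^sub>0 int) set"
  assumes S: "subgroup S (free_Abelian_group I)"
  obtains K :: "'i set" and v where "frag_extend v \<in> iso (free_Abelian_group K) (free_Abelian_group I\<lparr>carrier := S\<rparr>)"
proof -
  define J where "J k = {Poly_Mapping.lookup c k |c. c \<in> S \<and> Poly_Mapping.keys c \<subseteq> {..k}}" for k
  have zero: "0 \<in> S"
    using subgroup.one_closed [OF S] by simp
  have "\<exists>c. c \<in> S \<and> Poly_Mapping.keys c \<subseteq> {..k} \<and> (\<forall>x \<in> J k. Poly_Mapping.lookup c k dvd x)" for k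
  proof -
    have "0 \<in> J k"
      using zero unfolding J_def by force
    moreover have "x - y \<in> J k" if xy: "x \<in> J k" "y \<in> J k" for x y
    proof -
      obtain a b where ab: "a \<in> S" "Poly_Mapping.keys a \<subseteq> {..k}" "x = Poly_Mapping.lookup a k"
        "b \<in> S" "Poly_Mapping.keys b \<subseteq> {..k}" "y = Poly_Mapping.lookup b k"
        using xy unfolding J_def by blast
      have "Poly_Mapping.keys (a - b) \<subseteq> {..k}"
        using ab keys_diff [of a b] by blast
      then show ?thesis
        using ab diff_in_subgroup [OF S, of a b] unfolding J_def by (force simp: lookup_minus)
    qed
    moreover have "q * x \<in> J k" if "x \<in> J k" for q x
    proof -
      obtain a where a: "a \<in> S" "Poly_Mapping.keys a \<subseteq> {..k}" "x = Poly_Mapping.lookup a k"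
        using \<open>x \<in> J k\<close> unfolding J_def by blast
      have "Poly_Mapping.keys (frag_cmul q a) \<subseteq> {..k}"
        using a keys_cmul [of q a] by blast
      then show ?thesis
        using a frag_cmul_in_subgroup [OF S, of a q] unfolding J_def by force
    qed
    ultimately have "\<exists>d\<in>J k. \<forall>x\<in>J k. d dvd x"
      by (rule int_ideal_principal)
    then obtain d where d: "d \<in> J k" "\<And>x. x \<in> J k \<Longrightarrow> d dvd x"
      by blast
    obtain c where "c \<in> S" "Poly_Mapping.keys c \<subseteq> {..k}" "d = Poly_Mapping.lookup c k"
      using d(1) by (auto simp: J_def)
    with d(2) show ?thesis
      by auto
  qed
  then obtain v where vS: "\<And>k. v k \<in> S" and vk: "\<And>k. Poly_Mapping.keys (v k) \<subseteq> {..k}"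
    and vdvd: "\<And>k x. x \<in> J k \<Longrightarrow> Poly_Mapping.lookup (v k) k dvd x"
    by metis
  define K where "K = {k. Poly_Mapping.lookup (v k) k \<noteq> 0}"
  have sub: "frag_extend v x \<in> S" for x
  proof -
    have "x \<in> {x. frag_extend v x \<in> S}"
      using subset_UNIV
      by (induction x rule: frag_induction)
         (auto simp: zero vS frag_extend_diff intro: diff_in_subgroup [OF S])
    then show ?thesis by simp
  qed
  \<comment> \<open>At an upper bound \<open>m\<close> of the support only the summand \<open>v m\<close> contributes; this is the triangular form.\<close>
  have lead: "Poly_Mapping.lookup (frag_extend v x) m = Poly_Mapping.lookup x m * Poly_Mapping.lookup (v m) m"
    if "Poly_Mapping.keys x \<subseteq> {..m}" for x m
  proof -
    have "Poly_Mapping.lookup (frag_extend v x) m = (\<Sum>i\<in>Poly_Mapping.keys x. Poly_Mapping.lookup x i * Poly_Mapping.lookup (v i) m)"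
      by (simp add: frag_extend_def lookup_sum)
    also have "\<dots> = (\<Sum>i\<in>Poly_Mapping.keys x. if i = m then Poly_Mapping.lookup x m * Poly_Mapping.lookup (v m) m else 0)"
    proof (rule sum.cong)
      fix i assume "i \<in> Poly_Mapping.keys x"
      then have "Poly_Mapping.lookup (v i) m = 0" if "i \<noteq> m"
        using \<open>Poly_Mapping.keys x \<subseteq> {..m}\<close> vk [of i] that by (force simp: in_keys_iff)
      then show "Poly_Mapping.lookup x i * Poly_Mapping.lookup (v i) m = (if i = m then Poly_Mapping.lookup x m * Poly_Mapping.lookup (v m) m else 0)"
        by simp
    qed simp
    also have "\<dots> = Poly_Mapping.lookup x m * Poly_Mapping.lookup (v m) m"
      by (auto simp: in_keys_iff)
    finally show ?thesis .
  qed
  have inj: "x = 0" if "Poly_Mapping.keys x \<subseteq> K" "frag_extend v x = 0" for x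
  proof (rule ccontr)
    assume "x \<noteq> 0"
    then have ne: "Poly_Mapping.keys x \<noteq> {}" by simp
    have "Poly_Mapping.lookup x (Max (Poly_Mapping.keys x)) * Poly_Mapping.lookup (v (Max (Poly_Mapping.keys x))) (Max (Poly_Mapping.keys x)) = 0"
      using lead [of x "Max (Poly_Mapping.keys x)"] that(2) by (simp add: subset_eq)
    moreover have "Max (Poly_Mapping.keys x) \<in> Poly_Mapping.keys x"
      using ne by simp
    ultimately show False
      using that(1) by (auto simp: K_def in_keys_iff)
  qed
  have surj: "\<exists>x. Poly_Mapping.keys x \<subseteq> K \<and> frag_extend v x = c" if "c \<in> S" "Poly_Mapping.keys c \<subseteq> {..k}" for c k
    using that
  proof (induction k arbitrary: c rule: less_induct)
    case (less k)
    \<comment> \<open>Outside \<open>K\<close> the ideal at \<open>k\<close> is zero, so nothing has to be subtracted there.\<close>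
    define q where "q = Poly_Mapping.lookup c k div Poly_Mapping.lookup (v k) k"
    define y where "y = (if k \<in> K then frag_cmul q (frag_of k) else 0)"
    define c' where "c' = c - frag_extend v y"
    have dvd: "Poly_Mapping.lookup (v k) k dvd Poly_Mapping.lookup c k"
      using less.prems by (intro vdvd) (auto simp: J_def)
    have y: "Poly_Mapping.keys y \<subseteq> K" "Poly_Mapping.keys y \<subseteq> {..k}"
      by (auto simp: y_def split: if_splits)
    have "Poly_Mapping.lookup c' k = Poly_Mapping.lookup c k - Poly_Mapping.lookup y k * Poly_Mapping.lookup (v k) k"
      by (simp add: c'_def lookup_minus lead [OF y(2)])
    also have "\<dots> = 0"
      using dvd by (auto simp: y_def q_def K_def)
    finally have ck: "k \<notin> Poly_Mapping.keys c'"
      by (simp add: in_keys_iff)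
    have c'S: "c' \<in> S"
      unfolding c'_def by (intro diff_in_subgroup [OF S] less.prems sub)
    have "Poly_Mapping.keys (frag_extend v y) \<subseteq> {..k}"
    proof
      fix j assume "j \<in> Poly_Mapping.keys (frag_extend v y)"
      then obtain i where "i \<in> Poly_Mapping.keys y" "j \<in> Poly_Mapping.keys (v i)"
        using keys_frag_extend [of v y] by blast
      then have "j \<le> i" "i \<le> k"
        using vk y(2) by auto
      then show "j \<in> {..k}"
        by simp
    qed
    then have "Poly_Mapping.keys c' \<subseteq> {..k}"
      using keys_diff [of c "frag_extend v y"] less.prems unfolding c'_def by blast
    with ck have lt: "Poly_Mapping.keys c' \<subseteq> {..<k}"
      by (auto simp: subset_eq order.order_iff_strict)
    have "\<exists>x. Poly_Mapping.keys x \<subseteq> K \<and> frag_extend v x = c'"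
    proof (cases "Poly_Mapping.keys c' = {}")
      case True
      then show ?thesis
        by (intro exI [of _ 0]) simp
    next
      case False
      then have "Max (Poly_Mapping.keys c') < k"
        using lt Max_in [OF finite_keys False] by blast
      moreover have "Poly_Mapping.keys c' \<subseteq> {..Max (Poly_Mapping.keys c')}"
        by auto
      ultimately show ?thesis
        using less.IH c'S by blast
    qed
    then obtain x where x: "Poly_Mapping.keys x \<subseteq> K" "frag_extend v x = c'"
      by blast
    then have "frag_extend v (x + y) = c"
      by (simp add: frag_extend_add c'_def)
    moreover have "Poly_Mapping.keys (x + y) \<subseteq> K"
      using x(1) y(1) keys_add [of x y] by blast
    ultimately show ?case
      by blast
  qed
  have hom: "frag_extend v \<in> hom (free_Abelian_group K) (free_Abelian_group I\<lparr>carrier := S\<rparr>)"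
    by (rule homI) (simp_all add: sub frag_extend_add)
  have "inj_on (frag_extend v) (carrier (free_Abelian_group K))"
  proof (rule inj_onI)
    fix x y assume xy: "x \<in> carrier (free_Abelian_group K)" "y \<in> carrier (free_Abelian_group K)"
      "frag_extend v x = frag_extend v y"
    then have "Poly_Mapping.keys (x - y) \<subseteq> K"
      using keys_diff [of x y] by auto
    then show "x = y"
      using inj [of "x - y"] xy by (simp add: frag_extend_diff)
  qed
  moreover have "frag_extend v ` carrier (free_Abelian_group K) = S"
  proof
    show "S \<subseteq> frag_extend v ` carrier (free_Abelian_group K)"
    proof
      fix c assume "c \<in> S"
      then obtain x where "Poly_Mapping.keys x \<subseteq> K" "frag_extend v x = c"
        using surj [of c "Max (Poly_Mapping.keys c)"] by (auto simp: subset_eq)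
      then show "c \<in> frag_extend v ` carrier (free_Abelian_group K)"
        by force
    qed
  qed (auto simp: sub)
  ultimately have "frag_extend v \<in> iso (free_Abelian_group K) (free_Abelian_group I\<lparr>carrier := S\<rparr>)"
    using hom by (simp add: iso_def bij_betw_def)
  then show ?thesis
    by (rule that)
qed

lemma hom_free_Abelian_group_eqI:
  assumes G: "group G" and f: "f \<in> hom (free_Abelian_group K) G"
    and g: "g \<in> hom (free_Abelian_group K) G"
    and eq: "\<And>k. k \<in> K \<Longrightarrow> f (frag_of k) = g (frag_of k)" and x: "Poly_Mapping.keys x \<subseteq> K"
  shows "f x = g x"
proof -
  interpret f: group_hom "free_Abelian_group K" G f
    using f G by (simp add: group_hom_def group_hom_axioms_def)
  interpret g: group_hom "free_Abelian_group K" G g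
    using g G by (simp add: group_hom_def group_hom_axioms_def)
  show ?thesis
  proof (rule free_Abelian_group_induct [OF x, of "\<lambda>x. f x = g x"])
    show "f 0 = g 0"
      using f.hom_one g.hom_one by simp
    show "f (a - b) = g (a - b)"
      if ab: "Poly_Mapping.keys a \<subseteq> K" "Poly_Mapping.keys b \<subseteq> K" "f a = g a" "f b = g b" for a b
    proof -
      have "h (a - b) = h a \<otimes>\<^bsub>G\<^esub> inv\<^bsub>G\<^esub> (h b)" if "group_hom (free_Abelian_group K) G h" for h
      proof -
        interpret h: group_hom "free_Abelian_group K" G h by (rule that)
        show ?thesis
          using ab h.hom_mult [of a "- b"] h.hom_inv [of b] by simp
      qed
      from this [OF f.group_hom_axioms] this [OF g.group_hom_axioms] show ?thesis
        using ab by simp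
    qed
  qed (rule eq)
qed

text \<open>
  The form in which freeness is used: a homomorphism \<open>\<phi>\<close> on \<open>S\<close> lifts through \<open>p\<close> as soon as its
  values do, since the lifts may be chosen freely on a basis of \<open>S\<close>.
\<close>

theorem subgroup_of_free_Abelian_group_projective:
  fixes S :: "('i::wellorder \<Rightarrow>\<^sub>0 int) set"
  assumes S: "subgroup S (free_Abelian_group I)" and G: "comm_group G" and H: "group H"
    and p: "p \<in> hom G H" and \<phi>: "\<phi> \<in> hom (free_Abelian_group I\<lparr>carrier := S\<rparr>) H"
    and im: "\<phi> ` S \<subseteq> p ` carrier G"
  obtains \<psi> where "\<psi> \<in> hom (free_Abelian_group I\<lparr>carrier := S\<rparr>) G" "\<And>x. x \<in> S \<Longrightarrow> p (\<psi> x) = \<phi> x"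
proof -
  let ?S = "free_Abelian_group I\<lparr>carrier := S\<rparr>"
  obtain K :: "'i set" and v where v: "frag_extend v \<in> iso (free_Abelian_group K) ?S"
    using subgroup_of_free_Abelian_group_free [OF S] .
  let ?w = "inv_into (carrier (free_Abelian_group K)) (frag_extend v)"
  have w: "?w \<in> iso ?S (free_Abelian_group K)"
    using group.iso_set_sym [OF group_free_Abelian_group v] .
  have vh: "frag_extend v \<in> hom (free_Abelian_group K) ?S" and wh: "?w \<in> hom ?S (free_Abelian_group K)"
    using v w by (auto simp: iso_def)
  have vS: "v k \<in> S" if "k \<in> K" for k
    using hom_in_carrier [OF vh, of "frag_of k"] that by simp
  have "\<exists>g. g \<in> carrier G \<and> p g = \<phi> (v k)" if "k \<in> K" for k
    using im vS [OF that] by (metis image_iff subsetD imageI)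
  then obtain g where g: "\<And>k. k \<in> K \<Longrightarrow> g k \<in> carrier G \<and> p (g k) = \<phi> (v k)"
    by metis
  then obtain h where h: "h \<in> hom (free_Abelian_group K) G" "\<And>k. k \<in> K \<Longrightarrow> h (frag_of k) = g k"
    using comm_group.free_Abelian_group_universal [OF G, of g K] by blast
  have ph: "p (h x) = \<phi> (frag_extend v x)" if "Poly_Mapping.keys x \<subseteq> K" for x
  proof -
    have "(p \<circ> h) x = (\<phi> \<circ> frag_extend v) x"
      by (rule hom_free_Abelian_group_eqI [OF H hom_compose [OF h(1) p] hom_compose [OF vh \<phi>] _ that])
         (simp add: g h)
    then show ?thesis by simp
  qed
  show ?thesis
  proof
    show "h \<circ> ?w \<in> hom ?S G"
      by (rule hom_compose [OF wh h(1)])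
    fix x assume x: "x \<in> S"
    have "Poly_Mapping.keys (?w x) \<subseteq> K"
      using hom_in_carrier [OF wh] x by simp
    moreover have "frag_extend v (?w x) = x"
      using v x by (auto simp: iso_def bij_betw_def f_inv_into_f)
    ultimately show "p ((h \<circ> ?w) x) = \<phi> x"
      by (simp add: ph)
  qed
qed

section \<open>Cokernels and presentations\<close>

lemma group_homI:
  assumes "comm_group G" "comm_group H" "h \<in> hom G H"
  shows "group_hom G H h"
  using assms by (simp add: group_hom_def group_hom_axioms_def comm_group.axioms)

lemma image_normal:
  assumes "group_hom G H h" "comm_group H"
  shows "h ` carrier G \<lhd> H"
  using assms by (simp add: comm_group.normal_iff_subgroup group_hom.img_is_subgroup)

lemma comm_group_coker_group:
  assumes "group_hom G H h" "comm_group H"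
  shows "comm_group (coker_group G H h)"
  using assms by (simp add: coker_group_def comm_group.abelian_FactGroup group_hom.img_is_subgroup)

lemma carrier_coker_group: "carrier (coker_group G H h) = coker_proj G H h ` carrier H"
  by (simp add: coker_group_def coker_proj_def carrier_FactGroup)

lemma coker_proj_hom:
  assumes "group_hom G H h" "comm_group H"
  shows "coker_proj G H h \<in> hom H (coker_group G H h)"
  using normal.r_coset_hom_Mod [OF image_normal [OF assms]]
  by (simp add: coker_group_def coker_proj_def [abs_def])

lemma coker_proj_eq_one_iff:
  assumes "group_hom G H h" "x \<in> carrier H"
  shows "coker_proj G H h x = \<one>\<^bsub>coker_group G H h\<^esub> \<longleftrightarrow> x \<in> h ` carrier G"
proof -
  interpret group_hom G H h by fact
  show ?thesis
    using H.coset_join1 [OF _ assms(2) img_is_subgroup] H.coset_join2 [OF assms(2) img_is_subgroup]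
    by (auto simp: coker_group_def coker_proj_def)
qed

text \<open>
  Composing an isomorphism \<open>coker h \<cong> G\<close> with the projection turns it into a presentation of \<open>G\<close>: a
  surjection from \<open>R\<close> whose kernel is the image of \<open>h\<close>. Presentations avoid computing with cosets.
\<close>

lemma hom_to_coker_kernel:
  assumes h: "group_hom D R h" and R: "comm_group R" and \<alpha>: "\<alpha> \<in> iso (coker_group D R h) G" and G: "group G"
  defines "p \<equiv> \<alpha> \<circ> coker_proj D R h"
  shows "p \<in> hom R G" "p ` carrier R = carrier G" "kernel R G p = h ` carrier D"
proof -
  interpret C: comm_group "coker_group D R h"
    by (rule comm_group_coker_group [OF h R])
  interpret h: group_hom D R h by (rule h)
  interpret \<alpha>: group_hom "coker_group D R h" G \<alpha>
    using \<alpha> G by (simp add: group_hom_def group_hom_axioms_def C.is_group iso_def)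
  show "p \<in> hom R G"
    unfolding p_def by (rule hom_compose [OF coker_proj_hom [OF h R] \<alpha>.homh])
  show "p ` carrier R = carrier G"
    using \<alpha> by (simp only: p_def image_comp [symmetric] carrier_coker_group [symmetric] iso_def bij_betw_def mem_Collect_eq)
  have inj: "inj_on \<alpha> (carrier (coker_group D R h))"
    using \<alpha> by (simp add: iso_def bij_betw_def)
  have "p x = \<one>\<^bsub>G\<^esub> \<longleftrightarrow> x \<in> h ` carrier D" if "x \<in> carrier R" for x
  proof -
    have "coker_proj D R h x \<in> carrier (coker_group D R h)"
      using that by (simp add: carrier_coker_group)
    then have "p x = \<one>\<^bsub>G\<^esub> \<longleftrightarrow> coker_proj D R h x = \<one>\<^bsub>coker_group D R h\<^esub>"
      using inj_on_eq_iff [OF inj _ C.one_closed, of "coker_proj D R h x"] by (simp add: p_def)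
    then show ?thesis
      by (simp add: coker_proj_eq_one_iff [OF h that])
  qed
  then show "kernel R G p = h ` carrier D"
    using h.hom_closed by (auto simp: kernel_def)
qed

text \<open>
  The converse passage, from a presentation back to an isomorphism defined on cosets. On a coset of
  the kernel \<open>q\<close> is constant, so \<open>the_elem\<close> picks its only value.
\<close>

lemma coker_iso_of_presentation:
  assumes q: "group_hom R G q" and surj: "q ` carrier R = carrier G" and ker: "kernel R G q = h ` carrier D"
  shows "(\<lambda>X. the_elem (q ` X)) \<in> iso (coker_group D R h) G"
    and "x \<in> carrier R \<Longrightarrow> the_elem (q ` coker_proj D R h x) = q x"
proof -
  interpret q: group_hom R G q by (rule q)
  show "(\<lambda>X. the_elem (q ` X)) \<in> iso (coker_group D R h) G"
    using q.FactGroup_iso_set [OF surj] by (simp add: coker_group_def ker)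
  show "the_elem (q ` coker_proj D R h x) = q x" if "x \<in> carrier R"
  proof -
    have "q ` (kernel R G q #>\<^bsub>R\<^esub> x) = {q x}"
    proof
      show "q ` (kernel R G q #>\<^bsub>R\<^esub> x) \<subseteq> {q x}"
        using that by (auto simp: kernel_def r_coset_def)
      show "{q x} \<subseteq> q ` (kernel R G q #>\<^bsub>R\<^esub> x)"
        using q.G.rcos_self [OF that q.subgroup_kernel] by simp
    qed
    then show ?thesis
      unfolding coker_proj_def ker [symmetric] by simp
  qed
qed

lemma induced_map_coker_proj:
  assumes h: "group_hom D R h" and h': "group_hom D' R' h'" and R': "comm_group R'"
    and \<phi>: "\<phi> \<in> hom R R'" and sub: "\<phi> ` h ` carrier D \<subseteq> h' ` carrier D'" and x: "x \<in> carrier R"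
  shows "induced_map (coker_proj D' R' h') \<phi> (coker_proj D R h x) = coker_proj D' R' h' (\<phi> x)"
proof -
  interpret h: group_hom D R h by (rule h)
  interpret h': group_hom D' R' h' by (rule h')
  interpret \<phi>: group_hom R R' \<phi>
    using \<phi> by (simp add: group_hom_def group_hom_axioms_def h.H.is_group h'.H.is_group)
  interpret P: group_hom R' "coker_group D' R' h'" "coker_proj D' R' h'"
    by (rule group_homI [OF R' comm_group_coker_group [OF h' R'] coker_proj_hom [OF h' R']])
  have "coker_proj D' R' h' (\<phi> y) = coker_proj D' R' h' (\<phi> x)" if y: "y \<in> coker_proj D R h x" for y
  proof -
    obtain d where d: "d \<in> carrier D" "y = h d \<otimes>\<^bsub>R\<^esub> x"
      using y by (auto simp: coker_proj_def r_coset_def)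
    have "\<phi> (h d) \<in> h' ` carrier D'"
      using sub d by blast
    then have "coker_proj D' R' h' (\<phi> (h d)) = \<one>\<^bsub>coker_group D' R' h'\<^esub>"
      using d coker_proj_eq_one_iff [OF h'] by simp
    then show ?thesis
      using d x by simp
  qed
  moreover have "x \<in> coker_proj D R h x"
    using x h.H.rcos_self [OF x h.img_is_subgroup] by (simp add: coker_proj_def)
  ultimately show ?thesis
    unfolding induced_map_def by (intro UN_constant_eq ballI; blast)
qed

section \<open>Transport of exactness\<close>

text \<open>
  The transport lemmas spare a diagram chase in the sequence of the block matrix: once it is matched
  with an exact sequence by isomorphisms, it inherits both the homomorphism property and exactness.
\<close>

lemma exact_at_transport:
  assumes h1: "h1 ` carrier X1 = carrier Y1" and h2: "h2 \<in> iso X2 Y2" and h3: "h3 \<in> iso X3 Y3"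
    and X3: "group X3" and Y3: "group Y3"
    and f1: "f1 \<in> carrier X1 \<rightarrow> carrier X2" and f2: "f2 \<in> carrier X2 \<rightarrow> carrier X3"
    and sq1: "\<forall>x\<in>carrier X1. h2 (f1 x) = g1 (h1 x)" and sq2: "\<forall>x\<in>carrier X2. h3 (f2 x) = g2 (h2 x)"
    and ex: "g1 ` carrier Y1 = kernel Y2 Y3 g2"
  shows "f1 ` carrier X1 = kernel X2 X3 f2"
proof -
  interpret h3: group_hom X3 Y3 h3
    using h3 X3 Y3 by (simp add: group_hom_def group_hom_axioms_def iso_def)
  have inj2: "inj_on h2 (carrier X2)" and im2: "h2 ` carrier X2 = carrier Y2"
    and inj3: "inj_on h3 (carrier X3)"
    using h2 h3 by (auto simp: iso_def bij_betw_def)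
  have one: "f2 x = \<one>\<^bsub>X3\<^esub> \<longleftrightarrow> g2 (h2 x) = \<one>\<^bsub>Y3\<^esub>" if "x \<in> carrier X2" for x
    using that f2 sq2 inj_on_eq_iff [OF inj3, of "f2 x" "\<one>\<^bsub>X3\<^esub>"] by (auto simp: Pi_iff)
  have mem: "x \<in> f1 ` carrier X1 \<longleftrightarrow> h2 x \<in> g1 ` carrier Y1" if x: "x \<in> carrier X2" for x
  proof
    assume "x \<in> f1 ` carrier X1"
    then show "h2 x \<in> g1 ` carrier Y1"
      using sq1 h1 by auto
  next
    assume "h2 x \<in> g1 ` carrier Y1"
    then obtain z where z: "z \<in> carrier X1" "h2 x = g1 (h1 z)"
      by (auto simp: h1 [symmetric])
    then have "h2 (f1 z) = h2 x" "f1 z \<in> carrier X2"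
      using sq1 f1 by auto
    then have "f1 z = x"
      using inj_onD [OF inj2] x by blast
    then show "x \<in> f1 ` carrier X1"
      using z by blast
  qed
  have "f1 ` carrier X1 \<subseteq> carrier X2"
    using f1 by auto
  then show ?thesis
    using mem one im2 unfolding ex kernel_def by blast
qed

lemma hom_transport:
  assumes h1: "h1 \<in> iso X1 Y1" and h2: "h2 \<in> iso X2 Y2" and X1: "group X1" and X2: "group X2"
    and f: "f \<in> carrier X1 \<rightarrow> carrier X2" and g: "g \<in> hom Y1 Y2"
    and sq: "\<forall>x\<in>carrier X1. h2 (f x) = g (h1 x)"
  shows "f \<in> hom X1 X2"
proof (rule homI)
  interpret X1: group X1 by (rule X1)
  interpret X2: group X2 by (rule X2)
  show "f x \<in> carrier X2" if "x \<in> carrier X1" for x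
    using f that by auto
  fix x y assume xy: "x \<in> carrier X1" "y \<in> carrier X1"
  have h1h: "h1 \<in> hom X1 Y1" and h2h: "h2 \<in> hom X2 Y2" and inj2: "inj_on h2 (carrier X2)"
    using h1 h2 by (auto simp: iso_def bij_betw_def)
  have fxy: "f x \<in> carrier X2" "f y \<in> carrier X2" "f (x \<otimes>\<^bsub>X1\<^esub> y) \<in> carrier X2"
    using f xy by auto
  have "h2 (f (x \<otimes>\<^bsub>X1\<^esub> y)) = h2 (f x \<otimes>\<^bsub>X2\<^esub> f y)"
    using xy fxy sq hom_mult [OF h1h] hom_mult [OF h2h] hom_mult [OF g] hom_in_carrier [OF h1h]
    by simp
  then show "f (x \<otimes>\<^bsub>X1\<^esub> y) = f x \<otimes>\<^bsub>X2\<^esub> f y"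
    using inj_onD [OF inj2] fxy by blast
qed

lemma iso_image: "h \<in> iso M N \<Longrightarrow> h ` carrier M = carrier N"
  by (simp add: iso_def bij_betw_def)

lemma exact_six_term_transport:
  assumes iso: "six_term_iso (SixTerm X1 f1 X2 f2 X3 f3 X4 f4 X5 f5 X6 f6)
      (SixTerm Y1 g1 Y2 g2 Y3 g3 Y4 g4 Y5 g5 Y6 g6) h1 h2 h3 h4 h5 h6"
    and Y: "exact_six_term (SixTerm Y1 g1 Y2 g2 Y3 g3 Y4 g4 Y5 g5 Y6 g6)"
    and X: "comm_group X1" "comm_group X2" "comm_group X3" "comm_group X4" "comm_group X5" "comm_group X6"
    and f: "f1 \<in> carrier X1 \<rightarrow> carrier X2" "f2 \<in> carrier X2 \<rightarrow> carrier X3"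
      "f3 \<in> carrier X3 \<rightarrow> carrier X4" "f4 \<in> carrier X4 \<rightarrow> carrier X5"
      "f5 \<in> carrier X5 \<rightarrow> carrier X6" "f6 \<in> carrier X6 \<rightarrow> carrier X1"
  shows "exact_six_term (SixTerm X1 f1 X2 f2 X3 f3 X4 f4 X5 f5 X6 f6)"
proof -
  have h: "h1 \<in> iso X1 Y1" "h2 \<in> iso X2 Y2" "h3 \<in> iso X3 Y3" "h4 \<in> iso X4 Y4" "h5 \<in> iso X5 Y5" "h6 \<in> iso X6 Y6"
    and sq: "\<forall>x\<in>carrier X1. h2 (f1 x) = g1 (h1 x)" "\<forall>x\<in>carrier X2. h3 (f2 x) = g2 (h2 x)"
      "\<forall>x\<in>carrier X3. h4 (f3 x) = g3 (h3 x)" "\<forall>x\<in>carrier X4. h5 (f4 x) = g4 (h4 x)"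
      "\<forall>x\<in>carrier X5. h6 (f5 x) = g5 (h5 x)" "\<forall>x\<in>carrier X6. h1 (f6 x) = g6 (h6 x)"
    using iso by simp_all
  have g: "g1 \<in> hom Y1 Y2" "g2 \<in> hom Y2 Y3" "g3 \<in> hom Y3 Y4" "g4 \<in> hom Y4 Y5" "g5 \<in> hom Y5 Y6" "g6 \<in> hom Y6 Y1"
    and ex: "g1 ` carrier Y1 = kernel Y2 Y3 g2" "g2 ` carrier Y2 = kernel Y3 Y4 g3"
      "g3 ` carrier Y3 = kernel Y4 Y5 g4" "g4 ` carrier Y4 = kernel Y5 Y6 g5"
      "g5 ` carrier Y5 = kernel Y6 Y1 g6" "g6 ` carrier Y6 = kernel Y1 Y2 g1"
    and cY: "comm_group Y1" "comm_group Y2" "comm_group Y3" "comm_group Y4" "comm_group Y5" "comm_group Y6"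
    using Y by simp_all
  note gX = X [THEN comm_group.axioms(2)] and gY = cY [THEN comm_group.axioms(2)]
  show ?thesis
    unfolding exact_six_term.simps
    by (intro conjI X
        hom_transport [OF h(1) h(2) gX(1) gX(2) f(1) g(1) sq(1)]
        hom_transport [OF h(2) h(3) gX(2) gX(3) f(2) g(2) sq(2)]
        hom_transport [OF h(3) h(4) gX(3) gX(4) f(3) g(3) sq(3)]
        hom_transport [OF h(4) h(5) gX(4) gX(5) f(4) g(4) sq(4)]
        hom_transport [OF h(5) h(6) gX(5) gX(6) f(5) g(5) sq(5)]
        hom_transport [OF h(6) h(1) gX(6) gX(1) f(6) g(6) sq(6)]
        exact_at_transport [OF iso_image [OF h(1)] h(2) h(3) gX(3) gY(3) f(1) f(2) sq(1) sq(2) ex(1)]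
        exact_at_transport [OF iso_image [OF h(2)] h(3) h(4) gX(4) gY(4) f(2) f(3) sq(2) sq(3) ex(2)]
        exact_at_transport [OF iso_image [OF h(3)] h(4) h(5) gX(5) gY(5) f(3) f(4) sq(3) sq(4) ex(3)]
        exact_at_transport [OF iso_image [OF h(4)] h(5) h(6) gX(6) gY(6) f(4) f(5) sq(4) sq(5) ex(4)]
        exact_at_transport [OF iso_image [OF h(5)] h(6) h(1) gX(1) gY(1) f(5) f(6) sq(5) sq(6) ex(5)]
        exact_at_transport [OF iso_image [OF h(6)] h(1) h(2) gX(2) gY(2) f(6) f(1) sq(6) sq(1) ex(6)])
qed

section \<open>Homomorphisms between finitely or countably generated free groups\<close>

lemma comm_group_Zpow [simp]: "comm_group (Zpow n)"
  by (simp add: Zpow_def abelian_free_Abelian_group)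

lemma group_Zpow [simp]: "group (Zpow n)"
  by (simp add: Zpow_def)

lemma Zpow_simps [simp]:
  "x \<otimes>\<^bsub>Zpow n\<^esub> y = x + y" "\<one>\<^bsub>Zpow n\<^esub> = 0"
  by (simp_all add: Zpow_def)

lemma carrier_Zpow_iff: "x \<in> carrier (Zpow n) \<longleftrightarrow> Poly_Mapping.keys x \<subseteq> {i. enat i < n}"
  by (simp add: Zpow_def)

lemma Zpow_zero [simp]: "0 \<in> carrier (Zpow n)"
  by (simp add: carrier_Zpow_iff)

lemma Zpow_add [simp]: "\<lbrakk>x \<in> carrier (Zpow n); y \<in> carrier (Zpow n)\<rbrakk> \<Longrightarrow> x + y \<in> carrier (Zpow n)"
  unfolding carrier_Zpow_iff using keys_add [of x y] by blast

lemma Zpow_diff [simp]: "\<lbrakk>x \<in> carrier (Zpow n); y \<in> carrier (Zpow n)\<rbrakk> \<Longrightarrow> x - y \<in> carrier (Zpow n)"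
  unfolding carrier_Zpow_iff using keys_diff [of x y] by blast

lemma Zpow_minus [simp]: "- x \<in> carrier (Zpow n) \<longleftrightarrow> x \<in> carrier (Zpow n)"
  by (simp add: carrier_Zpow_iff)

lemma inv_Zpow [simp]: "x \<in> carrier (Zpow n) \<Longrightarrow> inv\<^bsub>Zpow n\<^esub> x = - x"
  unfolding Zpow_def by simp

lemma mat_hom_simps [simp]:
  "mat_hom A 0 = 0" "mat_hom A (x + y) = mat_hom A x + mat_hom A y"
  "mat_hom A (x - y) = mat_hom A x - mat_hom A y" "mat_hom A (- x) = - mat_hom A x"
  by (simp_all add: mat_hom_def frag_extend_add frag_extend_diff frag_extend_minus)

lemma mat_hom_zero [simp]: "mat_hom (\<lambda>_ _. 0) x = 0"
proof -
  have "Abs_poly_mapping (\<lambda>i::nat. 0::int) = 0"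
    by (intro poly_mapping_eqI) simp
  then show ?thesis
    by (simp add: mat_hom_def frag_extend_eq_0)
qed

text \<open>
  Column finiteness is what makes \<^const>\<open>Abs_poly_mapping\<close> meaningful on the columns.
\<close>

lemma lookup_column:
  assumes "A \<in> col_finite_mats m n"
  shows "Poly_Mapping.lookup (Abs_poly_mapping (\<lambda>i. A i j)) = (\<lambda>i. A i j)"
  using assms by (intro Abs_poly_mapping_inverse) (simp add: col_finite_mats_def)

lemma mat_hom_hom:
  assumes A: "A \<in> col_finite_mats m n"
  shows "mat_hom A \<in> hom (Zpow n) (Zpow m)"
proof (rule homI)
  fix x
  have "Poly_Mapping.keys (Abs_poly_mapping (\<lambda>i. A i j)) \<subseteq> {i. enat i < m}" for j
    using A by (auto simp: keys.rep_eq lookup_column [OF A] col_finite_mats_def)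
  then show "mat_hom A x \<in> carrier (Zpow m)"
    using keys_frag_extend [of "\<lambda>j. Abs_poly_mapping (\<lambda>i. A i j)" x]
    unfolding carrier_Zpow_iff mat_hom_def by blast
qed simp

lemma hom_Zpow_matrix:
  assumes f: "f \<in> hom (Zpow n) (Zpow m)"
  obtains Y where "Y \<in> col_finite_mats m n" "\<And>x. x \<in> carrier (Zpow n) \<Longrightarrow> mat_hom Y x = f x"
proof
  define Y where "Y = (\<lambda>i j. if enat j < n then Poly_Mapping.lookup (f (frag_of j)) i else 0)"
  show Y: "Y \<in> col_finite_mats m n"
  proof -
    have "enat i < m" if "enat j < n" "Poly_Mapping.lookup (f (frag_of j)) i \<noteq> 0" for i j
    proof -
      have "f (frag_of j) \<in> carrier (Zpow m)"
        using hom_in_carrier [OF f] that by (simp add: carrier_Zpow_iff)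
      then show ?thesis
        using that by (auto simp: carrier_Zpow_iff in_keys_iff subset_eq)
    qed
    moreover have "finite {i. Y i j \<noteq> 0}" for j
      by (simp add: Y_def)
    ultimately show ?thesis
      by (auto simp: col_finite_mats_def Y_def split: if_splits)
  qed
  fix x assume "x \<in> carrier (Zpow n)"
  then have x: "Poly_Mapping.keys x \<subseteq> {i. enat i < n}"
    by (simp add: carrier_Zpow_iff)
  have "mat_hom Y (frag_of j) = f (frag_of j)" if "enat j < n" for j
    using that by (intro poly_mapping_eqI) (simp add: mat_hom_def lookup_column [OF Y], simp add: Y_def)
  then show "mat_hom Y x = f x"
    using hom_free_Abelian_group_eqI [OF group_Zpow mat_hom_hom [OF Y, unfolded Zpow_def [of n]]
        f [unfolded Zpow_def [of n]] _ x] by simp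
qed

section \<open>Lifting and extension of homomorphisms\<close>

text \<open>
  Projectivity of the subgroups of \<^term>\<open>Zpow n\<close>, with \<open>\<phi>\<close> given only by its behaviour on \<open>S\<close>.
\<close>

lemma Zpow_subgroup_lift:
  assumes S: "subgroup S (Zpow n)" and G: "comm_group G" and H: "group H" and p: "p \<in> hom G H"
    and \<phi>: "\<And>x. x \<in> S \<Longrightarrow> \<phi> x \<in> p ` carrier G"
      "\<And>x y. \<lbrakk>x \<in> S; y \<in> S\<rbrakk> \<Longrightarrow> \<phi> (x + y) = \<phi> x \<otimes>\<^bsub>H\<^esub> \<phi> y"
  obtains \<psi> where "\<psi> \<in> hom (Zpow n\<lparr>carrier := S\<rparr>) G" "\<And>x. x \<in> S \<Longrightarrow> p (\<psi> x) = \<phi> x"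
proof (rule subgroup_of_free_Abelian_group_projective [OF S [unfolded Zpow_def] G H p])
  show "\<phi> \<in> hom (free_Abelian_group {i. enat i < n}\<lparr>carrier := S\<rparr>) H"
  proof (rule homI)
    show "\<phi> x \<in> carrier H" if "x \<in> carrier (free_Abelian_group {i. enat i < n}\<lparr>carrier := S\<rparr>)" for x
      using \<phi>(1) [of x] that hom_in_carrier [OF p] by auto
  qed (simp add: \<phi>(2))
  show "\<phi> ` S \<subseteq> p ` carrier G"
    using \<phi>(1) by blast
qed (use that in \<open>simp add: Zpow_def\<close>)

lemma Zpow_lift:
  assumes G: "comm_group G" and H: "group H" and p: "p \<in> hom G H"
    and \<phi>: "\<phi> \<in> hom (Zpow n) H" and im: "\<phi> ` carrier (Zpow n) \<subseteq> p ` carrier G"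
  obtains \<psi> where "\<psi> \<in> hom (Zpow n) G" "\<And>x. x \<in> carrier (Zpow n) \<Longrightarrow> p (\<psi> x) = \<phi> x"
proof (rule Zpow_subgroup_lift [OF group.subgroup_self [OF group_Zpow] G H p, of n \<phi>])
  show "\<phi> (x + y) = \<phi> x \<otimes>\<^bsub>H\<^esub> \<phi> y" if "x \<in> carrier (Zpow n)" "y \<in> carrier (Zpow n)" for x y
    using hom_mult [OF \<phi> that] by simp
qed (use im that in auto)

lemma ker_group_simps [simp]:
  "carrier (ker_group G H f) = kernel G H f"
  "x \<otimes>\<^bsub>ker_group G H f\<^esub> y = x \<otimes>\<^bsub>G\<^esub> y" "\<one>\<^bsub>ker_group G H f\<^esub> = \<one>\<^bsub>G\<^esub>"
  by (simp_all add: ker_group_def)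

lemma comm_group_ker_group:
  assumes "comm_group G" "group_hom G H f"
  shows "comm_group (ker_group G H f)"
proof -
  interpret G: comm_group G by (rule assms(1))
  have "group (ker_group G H f)"
    unfolding ker_group_def
    by (rule G.subgroup_imp_group [OF group_hom.subgroup_kernel [OF assms(2)]])
  then show ?thesis
    by (rule group.group_comm_groupI) (simp add: kernel_def G.m_comm)
qed

text \<open>
  The image of \<open>f\<close> is a subgroup of a free group, hence projective, so \<open>f\<close> has a section \<open>\<sigma>\<close> over its
  image. Then \<open>x \<mapsto> x - \<sigma> (f x)\<close> retracts \<^term>\<open>Zpow n\<close> onto the kernel.
\<close>

lemma Zpow_kernel_retraction:
  assumes f: "f \<in> hom (Zpow n) (Zpow m)"
  obtains \<pi> where "\<pi> \<in> hom (Zpow n) (ker_group (Zpow n) (Zpow m) f)"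
    "\<And>x. x \<in> kernel (Zpow n) (Zpow m) f \<Longrightarrow> \<pi> x = x"
proof -
  interpret f: group_hom "Zpow n" "Zpow m" f
    by (rule group_homI) (simp_all add: f)
  let ?S = "f ` carrier (Zpow n)"
  have f_add: "f (x + y) = f x + f y" if "x \<in> carrier (Zpow n)" "y \<in> carrier (Zpow n)" for x y
    using f.hom_mult [OF that] by simp
  have f_diff: "f (x - y) = f x - f y" if "x \<in> carrier (Zpow n)" "y \<in> carrier (Zpow n)" for x y
    using f_add [of "x - y" y] that by simp
  obtain \<sigma> where \<sigma>: "\<sigma> \<in> hom (Zpow m\<lparr>carrier := ?S\<rparr>) (Zpow n)" "\<And>y. y \<in> ?S \<Longrightarrow> f (\<sigma> y) = y"
    by (rule Zpow_subgroup_lift [OF f.img_is_subgroup comm_group_Zpow group_Zpow f, of "\<lambda>x. x"]) auto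
  have \<sigma>_add: "\<sigma> (x + y) = \<sigma> x + \<sigma> y" if "x \<in> ?S" "y \<in> ?S" for x y
    using hom_mult [OF \<sigma>(1)] that by simp
  have \<sigma>_in: "\<sigma> x \<in> carrier (Zpow n)" if "x \<in> ?S" for x
    using hom_in_carrier [OF \<sigma>(1)] that by simp
  have "0 \<in> ?S"
    using subgroup.one_closed [OF f.img_is_subgroup] by simp
  then have \<sigma>_0: "\<sigma> 0 = 0"
    using \<sigma>_add [of 0 0] by simp
  show ?thesis
  proof
    show "(\<lambda>x. x - \<sigma> (f x)) \<in> hom (Zpow n) (ker_group (Zpow n) (Zpow m) f)"
    proof (rule homI)
      show "x - \<sigma> (f x) \<in> carrier (ker_group (Zpow n) (Zpow m) f)" if "x \<in> carrier (Zpow n)" for x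
        using that by (simp add: kernel_def f_diff \<sigma>_in \<sigma>(2))
    qed (simp add: f_add \<sigma>_add)
    show "x - \<sigma> (f x) = x" if "x \<in> kernel (Zpow n) (Zpow m) f" for x
      using that by (simp add: kernel_def \<sigma>_0)
  qed
qed

text \<open>
  A lift \<open>u\<close> of \<open>w\<close> through \<open>e\<close> whose restriction to \<open>ker f\<close> is prescribed. It is obtained from an
  arbitrary lift by correcting it along the retraction onto \<open>ker f\<close>. This is the step that lets one
  matrix \<open>Y\<close> encode both the connecting map, which lives on \<open>ker B\<close>, and the extension of cokernels.
\<close>

lemma hom_Zpow_extend_lift:
  assumes G: "comm_group G" and H: "comm_group H" and e: "e \<in> hom G H"
    and w: "w \<in> hom (Zpow n) H" and im: "w ` carrier (Zpow n) \<subseteq> e ` carrier G"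
    and f: "f \<in> hom (Zpow n) (Zpow m)" and d: "d \<in> hom (ker_group (Zpow n) (Zpow m) f) G"
    and ed: "\<And>x. x \<in> kernel (Zpow n) (Zpow m) f \<Longrightarrow> e (d x) = w x"
  obtains u where "u \<in> hom (Zpow n) G" "\<And>x. x \<in> carrier (Zpow n) \<Longrightarrow> e (u x) = w x"
    "\<And>x. x \<in> kernel (Zpow n) (Zpow m) f \<Longrightarrow> u x = d x"
proof -
  interpret G: comm_group G by (rule G)
  interpret H: comm_group H by (rule H)
  obtain \<pi> where \<pi>: "\<pi> \<in> hom (Zpow n) (ker_group (Zpow n) (Zpow m) f)"
    and \<pi>_id: "\<And>x. x \<in> kernel (Zpow n) (Zpow m) f \<Longrightarrow> \<pi> x = x"
    using Zpow_kernel_retraction [OF f] by blast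
  obtain u0 where u0: "u0 \<in> hom (Zpow n) G" and eu0: "\<And>x. x \<in> carrier (Zpow n) \<Longrightarrow> e (u0 x) = w x"
    using Zpow_lift [OF G H.is_group e w im] by blast
  have \<pi>_ker: "\<pi> x \<in> kernel (Zpow n) (Zpow m) f" if "x \<in> carrier (Zpow n)" for x
    using hom_in_carrier [OF \<pi> that] by simp
  then have \<pi>_in: "\<pi> x \<in> carrier (Zpow n)" if "x \<in> carrier (Zpow n)" for x
    using that by (simp add: kernel_def)
  have \<pi>_add: "\<pi> (x + y) = \<pi> x + \<pi> y" if "x \<in> carrier (Zpow n)" "y \<in> carrier (Zpow n)" for x y
    using hom_mult [OF \<pi> that] by simp
  have u0_add: "u0 (x + y) = u0 x \<otimes>\<^bsub>G\<^esub> u0 y" if "x \<in> carrier (Zpow n)" "y \<in> carrier (Zpow n)" for x y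
    using hom_mult [OF u0 that] by simp
  have u0_in: "u0 x \<in> carrier G" if "x \<in> carrier (Zpow n)" for x
    using hom_in_carrier [OF u0 that] .
  have d_in: "d x \<in> carrier G" if "x \<in> kernel (Zpow n) (Zpow m) f" for x
    using hom_in_carrier [OF d] that by simp
  have d_add: "d (x + y) = d x \<otimes>\<^bsub>G\<^esub> d y"
    if "x \<in> kernel (Zpow n) (Zpow m) f" "y \<in> kernel (Zpow n) (Zpow m) f" for x y
    using hom_mult [OF d] that by simp
  \<comment> \<open>On \<open>ker f\<close> the second factor vanishes; in general the two factors split \<open>x\<close> as \<open>\<pi> x + (x - \<pi> x)\<close>.\<close>
  define u where "u x = d (\<pi> x) \<otimes>\<^bsub>G\<^esub> u0 (x - \<pi> x)" for x
  show ?thesis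
  proof
    show "u \<in> hom (Zpow n) G"
    proof (rule homI)
      fix x y assume xy: "x \<in> carrier (Zpow n)" "y \<in> carrier (Zpow n)"
      have eq: "x + y - \<pi> (x + y) = (x - \<pi> x) + (y - \<pi> y)"
        by (simp add: \<pi>_add xy)
      have "u0 (x + y - \<pi> (x + y)) = u0 (x - \<pi> x) \<otimes>\<^bsub>G\<^esub> u0 (y - \<pi> y)"
        unfolding eq by (rule u0_add) (simp_all add: xy \<pi>_in)
      moreover have "d (\<pi> (x + y)) = d (\<pi> x) \<otimes>\<^bsub>G\<^esub> d (\<pi> y)"
        using xy by (simp add: \<pi>_add d_add \<pi>_ker)
      ultimately show "u (x \<otimes>\<^bsub>Zpow n\<^esub> y) = u x \<otimes>\<^bsub>G\<^esub> u y"
        using xy by (simp add: u_def d_in \<pi>_ker u0_in \<pi>_in G.m_ac)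
    qed (simp add: u_def d_in \<pi>_ker u0_in \<pi>_in)
    show "e (u x) = w x" if x: "x \<in> carrier (Zpow n)" for x
    proof -
      have "e (u x) = w (\<pi> x) \<otimes>\<^bsub>H\<^esub> w (x - \<pi> x)"
        using x by (simp add: u_def hom_mult [OF e] d_in \<pi>_ker u0_in \<pi>_in ed eu0)
      also have "\<dots> = w (\<pi> x + (x - \<pi> x))"
        using hom_mult [OF w, of "\<pi> x" "x - \<pi> x"] x \<pi>_in by simp
      finally show ?thesis by simp
    qed
    show "u x = d x" if x: "x \<in> kernel (Zpow n) (Zpow m) f" for x
    proof -
      have "u0 0 = \<one>\<^bsub>G\<^esub>"
        using hom_one [OF u0 group_Zpow G.is_group] by simp
      then show ?thesis
        using x by (simp add: u_def \<pi>_id d_in)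
    qed
  qed
qed

section \<open>The block matrix\<close>

lemma block_hom_apply:
  "block_hom A Y (\<lambda>_ _. 0) B (x, y) = (mat_hom A x + mat_hom Y y, mat_hom B y)"
  by (simp add: block_hom_def)

lemma block_hom_hom:
  assumes "A \<in> col_finite_mats n1 n1'" "Y \<in> col_finite_mats n1 n3'" "B \<in> col_finite_mats n3 n3'"
  shows "block_hom A Y (\<lambda>_ _. 0) B \<in> hom (Zpow n1' \<times>\<times> Zpow n3') (Zpow n1 \<times>\<times> Zpow n3)"
proof (rule homI)
  note in_carrier = hom_in_carrier [OF mat_hom_hom [OF assms(1)]] hom_in_carrier [OF mat_hom_hom [OF assms(2)]]
    hom_in_carrier [OF mat_hom_hom [OF assms(3)]]
  show "block_hom A Y (\<lambda>_ _. 0) B x \<in> carrier (Zpow n1 \<times>\<times> Zpow n3)"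
    if "x \<in> carrier (Zpow n1' \<times>\<times> Zpow n3')" for x
    using that by (auto simp: block_hom_apply in_carrier)
  show "block_hom A Y (\<lambda>_ _. 0) B (x \<otimes>\<^bsub>Zpow n1' \<times>\<times> Zpow n3'\<^esub> y) =
      block_hom A Y (\<lambda>_ _. 0) B x \<otimes>\<^bsub>Zpow n1 \<times>\<times> Zpow n3\<^esub> block_hom A Y (\<lambda>_ _. 0) B y" for x y
    by (cases x; cases y) (simp add: block_hom_apply algebra_simps)
qed

lemma comm_group_Zpow_prod [simp]: "comm_group (Zpow m \<times>\<times> Zpow n)"
  by (rule group.group_comm_groupI) (auto simp: DirProd_group add.commute)

lemma one_Zpow_prod [simp]: "\<one>\<^bsub>Zpow m \<times>\<times> Zpow n\<^esub> = (0, 0)"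
  by (simp add: DirProd_def)

lemma block_kernel_iff:
  "(x, y) \<in> kernel (Zpow n1' \<times>\<times> Zpow n3') (Zpow n1 \<times>\<times> Zpow n3) (block_hom A Y (\<lambda>_ _. 0) B) \<longleftrightarrow>
   x \<in> carrier (Zpow n1') \<and> y \<in> carrier (Zpow n3') \<and> mat_hom A x + mat_hom Y y = 0 \<and> mat_hom B y = 0"
  by (auto simp: kernel_def block_hom_apply)

lemma kernel_Zpow_iff: "x \<in> kernel (Zpow n) (Zpow m) f \<longleftrightarrow> x \<in> carrier (Zpow n) \<and> f x = 0"
  by (simp add: kernel_def)

text \<open>
  Both \<open>ker (A Y; 0 B)\<close> and \<open>F2\<close> are extensions of the same subgroup \<open>K\<close> of \<open>ker B\<close> by \<open>ker A \<cong> F1\<close>: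
  \<open>K\<close> consists of the \<open>y\<close> with \<open>Y y \<in> im A\<close>, which by the assumption on ranges are those with
  \<open>b3 y \<in> im c\<close>. As a subgroup of a free group \<open>K\<close> is projective, so both extensions split, by
  \<open>y \<mapsto> (r y, y)\<close> and by \<open>g\<close>, and matching the splittings gives the isomorphism
  \<open>(x, y) \<mapsto> e (b1 (x - r y)) + g y\<close>, in additive notation.
\<close>

lemma block_kernel_iso:
  fixes n1 n1' n3 n3' :: enat and A B Y :: "nat \<Rightarrow> nat \<Rightarrow> int"
  defines "N \<equiv> ker_group (Zpow n1' \<times>\<times> Zpow n3') (Zpow n1 \<times>\<times> Zpow n3) (block_hom A Y (\<lambda>_ _. 0) B)"
  assumes A: "A \<in> col_finite_mats n1 n1'" and Y: "Y \<in> col_finite_mats n1 n3'" and B: "B \<in> col_finite_mats n3 n3'"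
    and F1: "comm_group F1" and F2: "comm_group F2" and F3: "comm_group F3"
    and e: "e \<in> hom F1 F2" and inj_e: "inj_on e (carrier F1)"
    and c: "c \<in> hom F2 F3" and exact: "e ` carrier F1 = kernel F2 F3 c"
    and b1: "b1 \<in> iso (mat_ker n1 n1' A) F1" and b3: "b3 \<in> iso (mat_ker n3 n3' B) F3"
    and range: "\<And>y. y \<in> kernel (Zpow n3') (Zpow n3) (mat_hom B) \<Longrightarrow>
      b3 y \<in> c ` carrier F2 \<longleftrightarrow> mat_hom Y y \<in> mat_hom A ` carrier (Zpow n1')"
  obtains b2 where "b2 \<in> iso N F2"
    "\<And>x. x \<in> kernel (Zpow n1') (Zpow n1) (mat_hom A) \<Longrightarrow> b2 (x, 0) = e (b1 x)"
    "\<And>z. z \<in> carrier N \<Longrightarrow> c (b2 z) = b3 (snd z)"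
proof -
  interpret F1: comm_group F1 by (rule F1)
  interpret F2: comm_group F2 by (rule F2)
  interpret F3: comm_group F3 by (rule F3)
  interpret e: group_hom F1 F2 e by (rule group_homI [OF F1 F2 e])
  interpret c: group_hom F2 F3 c by (rule group_homI [OF F2 F3 c])
  let ?kA = "kernel (Zpow n1') (Zpow n1) (mat_hom A)" and ?kB = "kernel (Zpow n3') (Zpow n3) (mat_hom B)"
  have hA: "group_hom (Zpow n1') (Zpow n1) (mat_hom A)" and hB: "group_hom (Zpow n3') (Zpow n3) (mat_hom B)"
    and hY: "group_hom (Zpow n3') (Zpow n1) (mat_hom Y)"
    by (simp_all add: group_homI mat_hom_hom A B Y)
  interpret kA: comm_group "mat_ker n1 n1' A" by (rule comm_group_ker_group [OF _ hA]) simp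
  interpret kB: comm_group "mat_ker n3 n3' B" by (rule comm_group_ker_group [OF _ hB]) simp
  interpret b1: group_hom "mat_ker n1 n1' A" F1 b1
    using b1 by (simp add: group_hom_def group_hom_axioms_def kA.is_group F1.is_group iso_def)
  interpret b3: group_hom "mat_ker n3 n3' B" F3 b3
    using b3 by (simp add: group_hom_def group_hom_axioms_def kB.is_group F3.is_group iso_def)
  have hM: "group_hom (Zpow n1' \<times>\<times> Zpow n3') (Zpow n1 \<times>\<times> Zpow n3) (block_hom A Y (\<lambda>_ _. 0) B)"
    by (simp add: group_homI block_hom_hom A B Y)
  interpret N: comm_group N
    unfolding N_def by (rule comm_group_ker_group [OF _ hM]) simp
  have N_iff: "(x, y) \<in> carrier N \<longleftrightarrow> x \<in> carrier (Zpow n1') \<and> y \<in> carrier (Zpow n3') \<and>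
      mat_hom A x + mat_hom Y y = 0 \<and> mat_hom B y = 0" for x y
    by (simp add: N_def block_kernel_iff)
  have N_mult: "(x, y) \<otimes>\<^bsub>N\<^esub> (x', y') = (x + x', y + y')" for x y x' y'
    by (simp add: N_def)
  have N_one: "\<one>\<^bsub>N\<^esub> = (0, 0)"
    by (simp add: N_def)
  have b1_in: "b1 x \<in> carrier F1" if "x \<in> ?kA" for x
    using b1.hom_closed that by simp
  have b3_in: "b3 x \<in> carrier F3" if "x \<in> ?kB" for x
    using b3.hom_closed that by simp
  have b1_add: "b1 (x + y) = b1 x \<otimes>\<^bsub>F1\<^esub> b1 y" if "x \<in> ?kA" "y \<in> ?kA" for x y
    using b1.hom_mult that by simp
  have b3_add: "b3 (x + y) = b3 x \<otimes>\<^bsub>F3\<^esub> b3 y" if "x \<in> ?kB" "y \<in> ?kB" for x y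
    using b3.hom_mult that by simp
  have b1_0: "b1 0 = \<one>\<^bsub>F1\<^esub>" and b3_0: "b3 0 = \<one>\<^bsub>F3\<^esub>"
    using b1.hom_one b3.hom_one by simp_all
  have b1_inj: "x = 0" if "x \<in> ?kA" "b1 x = \<one>\<^bsub>F1\<^esub>" for x
    using b1 b1_0 that inj_onD [of b1 ?kA x 0] by (simp add: iso_def bij_betw_def kernel_Zpow_iff)
  have b3_inj: "x = 0" if "x \<in> ?kB" "b3 x = \<one>\<^bsub>F3\<^esub>" for x
    using b3 b3_0 that inj_onD [of b3 ?kB x 0] by (simp add: iso_def bij_betw_def kernel_Zpow_iff)
  have b1_surj: "\<exists>x\<in>?kA. b1 x = g" if "g \<in> carrier F1" for g
    using iso_image [OF b1] that by (metis imageE ker_group_simps(1))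
  have b3_surj: "\<exists>x\<in>?kB. b3 x = g" if "g \<in> carrier F3" for g
    using iso_image [OF b3] that by (metis imageE ker_group_simps(1))
  define K where "K = {y \<in> ?kB. mat_hom Y y \<in> mat_hom A ` carrier (Zpow n1')}"
  have K_kB: "y \<in> ?kB" if "y \<in> K" for y
    using that by (simp add: K_def)
  have K: "subgroup K (Zpow n3')"
  proof
    show "K \<subseteq> carrier (Zpow n3')"
      by (auto simp: K_def kernel_def)
    have "0 \<in> mat_hom A ` carrier (Zpow n1')"
      by (rule image_eqI [of _ _ 0]) simp_all
    then show "\<one>\<^bsub>Zpow n3'\<^esub> \<in> K"
      by (simp add: K_def kernel_Zpow_iff)
    fix y assume y: "y \<in> K"
    then obtain x where x: "x \<in> carrier (Zpow n1')" "mat_hom Y y = mat_hom A x"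
      by (auto simp: K_def)
    have "mat_hom Y (- y) = mat_hom A (- x)" "- x \<in> carrier (Zpow n1')"
      using x by simp_all
    then have "mat_hom Y (- y) \<in> mat_hom A ` carrier (Zpow n1')"
      by blast
    with y show "inv\<^bsub>Zpow n3'\<^esub> y \<in> K"
      by (simp add: K_def kernel_Zpow_iff)
    fix y' assume y': "y' \<in> K"
    then obtain x' where x': "x' \<in> carrier (Zpow n1')" "mat_hom Y y' = mat_hom A x'"
      by (auto simp: K_def)
    have "mat_hom Y (y + y') = mat_hom A (x + x')" "x + x' \<in> carrier (Zpow n1')"
      using x x' by simp_all
    then have "mat_hom Y (y + y') \<in> mat_hom A ` carrier (Zpow n1')"
      by blast
    with y y' show "y \<otimes>\<^bsub>Zpow n3'\<^esub> y' \<in> K"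
      by (simp add: K_def kernel_Zpow_iff)
  qed
  obtain r where r: "r \<in> hom (Zpow n3'\<lparr>carrier := K\<rparr>) (Zpow n1')"
    and Ar: "\<And>y. y \<in> K \<Longrightarrow> mat_hom A (r y) = - mat_hom Y y"
  proof (rule Zpow_subgroup_lift [OF K comm_group_Zpow group_Zpow mat_hom_hom [OF A], of "\<lambda>y. - mat_hom Y y"])
    fix y assume "y \<in> K"
    then obtain x where "x \<in> carrier (Zpow n1')" "mat_hom Y y = mat_hom A x"
      by (auto simp: K_def)
    then have "- mat_hom Y y = mat_hom A (- x)" "- x \<in> carrier (Zpow n1')"
      by simp_all
    then show "- mat_hom Y y \<in> mat_hom A ` carrier (Zpow n1')"
      by blast
  qed simp_all
  obtain g where g: "g \<in> hom (Zpow n3'\<lparr>carrier := K\<rparr>) F2" and cg: "\<And>y. y \<in> K \<Longrightarrow> c (g y) = b3 y"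
    by (rule Zpow_subgroup_lift [OF K F2 F3.is_group c, of b3]) (auto simp: K_def range b3_add)
  have r_in: "r y \<in> carrier (Zpow n1')" and g_in: "g y \<in> carrier F2" if "y \<in> K" for y
    using hom_in_carrier [OF r] hom_in_carrier [OF g] that by simp_all
  have r_add: "r (y + y') = r y + r y'" and g_add: "g (y + y') = g y \<otimes>\<^bsub>F2\<^esub> g y'"
    if "y \<in> K" "y' \<in> K" for y y'
    using hom_mult [OF r] hom_mult [OF g] that by simp_all
  have K0: "0 \<in> K"
    using subgroup.one_closed [OF K] by simp
  have r0: "r 0 = 0"
    using r_add [OF K0 K0] by simp
  have g0: "g 0 = \<one>\<^bsub>F2\<^esub>"
    using g_add [OF K0 K0] g_in [OF K0] F2.l_cancel_one' by simp
  have N_K: "y \<in> K" if "(x, y) \<in> carrier N" for x y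
  proof -
    have "mat_hom Y y = mat_hom A (- x)" "- x \<in> carrier (Zpow n1')"
      using that by (simp_all add: N_iff eq_neg_iff_add_eq_0 add.commute)
    then have "mat_hom Y y \<in> mat_hom A ` carrier (Zpow n1')"
      by (rule image_eqI)
    then show ?thesis
      using that by (simp add: K_def N_iff kernel_Zpow_iff)
  qed
  have N_kA: "x - r y \<in> ?kA" if "(x, y) \<in> carrier N" for x y
    using that N_K [OF that] by (simp add: N_iff kernel_Zpow_iff r_in Ar)
  define b2 where "b2 = (\<lambda>(x, y). e (b1 (x - r y)) \<otimes>\<^bsub>F2\<^esub> g y)"
  have b2_hom: "b2 \<in> hom N F2"
  proof (rule homI)
    show "b2 z \<in> carrier F2" if "z \<in> carrier N" for z
      using that N_kA N_K by (cases z) (auto simp: b2_def b1_in g_in)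
    show "b2 (z \<otimes>\<^bsub>N\<^esub> z') = b2 z \<otimes>\<^bsub>F2\<^esub> b2 z'" if "z \<in> carrier N" "z' \<in> carrier N" for z z'
    proof -
      obtain x y x' y' where z: "z = (x, y)" "z' = (x', y')"
        by (cases z; cases z') auto
      have xy: "x - r y \<in> ?kA" "y \<in> K" "x' - r y' \<in> ?kA" "y' \<in> K"
        using that N_kA N_K unfolding z by blast+
      have eq: "x + x' - r (y + y') = (x - r y) + (x' - r y')"
        by (simp add: r_add xy)
      have "b2 (z \<otimes>\<^bsub>N\<^esub> z') = e (b1 ((x - r y) + (x' - r y'))) \<otimes>\<^bsub>F2\<^esub> g (y + y')"
        by (simp only: z N_mult b2_def prod.case eq)
      also have "\<dots> = (e (b1 (x - r y)) \<otimes>\<^bsub>F2\<^esub> e (b1 (x' - r y'))) \<otimes>\<^bsub>F2\<^esub> (g y \<otimes>\<^bsub>F2\<^esub> g y')"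
        by (simp only: b1_add g_add xy e.hom_mult b1_in)
      also have "\<dots> = b2 z \<otimes>\<^bsub>F2\<^esub> b2 z'"
        using xy by (simp add: z b2_def F2.m_ac b1_in g_in)
      finally show ?thesis .
    qed
  qed
  have ce: "c (e f) = \<one>\<^bsub>F3\<^esub>" if "f \<in> carrier F1" for f
    using exact that by (auto simp: kernel_def)
  have cb2: "c (b2 z) = b3 (snd z)" if "z \<in> carrier N" for z
    using that N_kA N_K K_kB by (cases z) (simp add: b2_def b1_in g_in ce cg b3_in)
  interpret b2: group_hom N F2 b2
    using b2_hom by (simp add: group_hom_def group_hom_axioms_def N.is_group F2.is_group)
  have "kernel N F2 b2 = {\<one>\<^bsub>N\<^esub>}"
  proof
    show "kernel N F2 b2 \<subseteq> {\<one>\<^bsub>N\<^esub>}"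
    proof
      fix z assume z: "z \<in> kernel N F2 b2"
      obtain x y where xy: "z = (x, y)"
        by (cases z)
      have N: "(x, y) \<in> carrier N" and b2z: "b2 (x, y) = \<one>\<^bsub>F2\<^esub>"
        using z by (simp_all add: kernel_def xy)
      have "b3 y = \<one>\<^bsub>F3\<^esub>"
        using cb2 [OF N] b2z by simp
      then have y: "y = 0"
        using b3_inj K_kB [OF N_K [OF N]] by blast
      then have "e (b1 x) = \<one>\<^bsub>F2\<^esub>" and x: "x \<in> ?kA"
        using b2z N_kA [OF N] by (simp_all add: b2_def r0 g0 b1_in)
      then have "b1 x = \<one>\<^bsub>F1\<^esub>"
        using inj_onD [OF inj_e, of "b1 x" "\<one>\<^bsub>F1\<^esub>"] b1_in by simp
      then have "x = 0"
        using b1_inj x by blast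
      with y show "z \<in> {\<one>\<^bsub>N\<^esub>}"
        by (simp add: xy N_one)
    qed
  qed (simp add: kernel_def)
  moreover have "b2 ` carrier N = carrier F2"
  proof
    show "carrier F2 \<subseteq> b2 ` carrier N"
    proof
      fix f assume f: "f \<in> carrier F2"
      then obtain y where y: "y \<in> ?kB" "b3 y = c f"
        using b3_surj c.hom_closed by blast
      then have yK: "y \<in> K"
        using range [OF y(1)] f by (auto simp: K_def)
      let ?f' = "f \<otimes>\<^bsub>F2\<^esub> inv\<^bsub>F2\<^esub> g y"
      have "?f' \<in> kernel F2 F3 c"
        using f yK y by (simp add: kernel_def g_in cg)
      then obtain k where "k \<in> carrier F1" "e k = ?f'"
        unfolding exact [symmetric] by auto
      then obtain x where x: "x \<in> ?kA" "e (b1 x) = ?f'"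
        using b1_surj by blast
      have "(x + r y, y) \<in> carrier N"
        using x(1) y(1) yK by (simp add: N_iff kernel_Zpow_iff r_in Ar)
      moreover have "b2 (x + r y, y) = f"
        using x(2) f yK by (simp add: b2_def g_in F2.m_assoc)
      ultimately show "f \<in> b2 ` carrier N"
        by (metis image_eqI)
    qed
  qed auto
  ultimately have "b2 \<in> iso N F2"
    using iso_kernel_image [OF N.is_group F2.is_group] b2_hom by blast
  moreover have "b2 (x, 0) = e (b1 x)" if "x \<in> ?kA" for x
    using that by (simp add: b2_def r0 g0 b1_in)
  ultimately show ?thesis
    using that cb2 by blast
qed

text \<open>
  A presentation of \<open>G2\<close> by the block matrix, built from presentations of \<open>G1\<close> and \<open>G3\<close> as in the
  horseshoe lemma. The columns of \<open>B\<close>, lifted by \<open>s\<close>, vanish only up to elements from \<open>G1\<close>,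
  and \<open>Y\<close> records these (\<open>eY\<close>). As \<open>e\<close> need not be injective, further relations are needed for
  \<open>ker e\<close>; they come from the restriction of \<open>Y\<close> to \<open>ker B\<close> (\<open>ker_e\<close>).
\<close>

lemma block_coker_presentation:
  fixes n1 n1' n3 n3' :: enat and A B Y :: "nat \<Rightarrow> nat \<Rightarrow> int"
  defines "M \<equiv> block_hom A Y (\<lambda>_ _. 0) B"
  assumes A: "A \<in> col_finite_mats n1 n1'" and Y: "Y \<in> col_finite_mats n1 n3'" and B: "B \<in> col_finite_mats n3 n3'"
    and G1: "comm_group G1" and G2: "comm_group G2" and G3: "comm_group G3"
    and e: "e \<in> hom G1 G2" and c: "c \<in> hom G2 G3" and exact: "e ` carrier G1 = kernel G2 G3 c"
    and p1: "p1 \<in> hom (Zpow n1) G1" "p1 ` carrier (Zpow n1) = carrier G1"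
      "kernel (Zpow n1) G1 p1 = mat_hom A ` carrier (Zpow n1')"
    and p3: "p3 \<in> hom (Zpow n3) G3" "p3 ` carrier (Zpow n3) = carrier G3"
      "kernel (Zpow n3) G3 p3 = mat_hom B ` carrier (Zpow n3')"
    and s: "s \<in> hom (Zpow n3) G2" and cs: "\<And>x. x \<in> carrier (Zpow n3) \<Longrightarrow> c (s x) = p3 x"
    and eY: "\<And>y. y \<in> carrier (Zpow n3') \<Longrightarrow> e (p1 (mat_hom Y y)) \<otimes>\<^bsub>G2\<^esub> s (mat_hom B y) = \<one>\<^bsub>G2\<^esub>"
    and ker_e: "kernel G1 G2 e \<subseteq> (\<lambda>y. p1 (mat_hom Y y)) ` kernel (Zpow n3') (Zpow n3) (mat_hom B)"
  defines "q \<equiv> \<lambda>(x, z). e (p1 x) \<otimes>\<^bsub>G2\<^esub> s z"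
  shows "q \<in> hom (Zpow n1 \<times>\<times> Zpow n3) G2" "q ` carrier (Zpow n1 \<times>\<times> Zpow n3) = carrier G2"
    "kernel (Zpow n1 \<times>\<times> Zpow n3) G2 q = M ` carrier (Zpow n1' \<times>\<times> Zpow n3')"
proof -
  interpret G1: comm_group G1 by (rule G1)
  interpret G2: comm_group G2 by (rule G2)
  interpret G3: comm_group G3 by (rule G3)
  interpret e: group_hom G1 G2 e by (rule group_homI [OF G1 G2 e])
  interpret c: group_hom G2 G3 c by (rule group_homI [OF G2 G3 c])
  interpret p1: group_hom "Zpow n1" G1 p1 by (rule group_homI [OF _ G1 p1(1)]) simp
  interpret p3: group_hom "Zpow n3" G3 p3 by (rule group_homI [OF _ G3 p3(1)]) simp
  interpret s: group_hom "Zpow n3" G2 s by (rule group_homI [OF _ G2 s]) simp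
  note A_in = hom_in_carrier [OF mat_hom_hom [OF A]] and Y_in = hom_in_carrier [OF mat_hom_hom [OF Y]]
    and B_in = hom_in_carrier [OF mat_hom_hom [OF B]]
  have p1_add: "p1 (x + y) = p1 x \<otimes>\<^bsub>G1\<^esub> p1 y" if "x \<in> carrier (Zpow n1)" "y \<in> carrier (Zpow n1)" for x y
    using p1.hom_mult [OF that] by simp
  have p1_diff: "p1 (x - y) = p1 x \<otimes>\<^bsub>G1\<^esub> inv\<^bsub>G1\<^esub> p1 y" if "x \<in> carrier (Zpow n1)" "y \<in> carrier (Zpow n1)" for x y
    using p1_add [of x "- y"] p1.hom_inv [of y] that by simp
  have s_add: "s (x + y) = s x \<otimes>\<^bsub>G2\<^esub> s y" if "x \<in> carrier (Zpow n3)" "y \<in> carrier (Zpow n3)" for x y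
    using s.hom_mult [OF that] by simp
  have ce: "c (e f) = \<one>\<^bsub>G3\<^esub>" if "f \<in> carrier G1" for f
    using exact that by (auto simp: kernel_def)
  have pA: "p1 (mat_hom A x) = \<one>\<^bsub>G1\<^esub>" if "x \<in> carrier (Zpow n1')" for x
    using p1(3) that by (auto simp: kernel_def)
  show "q \<in> hom (Zpow n1 \<times>\<times> Zpow n3) G2"
    by (rule homI) (auto simp: q_def p1_add s_add G2.m_ac)
  show "q ` carrier (Zpow n1 \<times>\<times> Zpow n3) = carrier G2"
  proof
    show "carrier G2 \<subseteq> q ` carrier (Zpow n1 \<times>\<times> Zpow n3)"
    proof
      fix g assume g: "g \<in> carrier G2"
      then have "c g \<in> p3 ` carrier (Zpow n3)"
        by (simp add: p3(2))
      then obtain z where z: "z \<in> carrier (Zpow n3)" "c g = p3 z"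
        by blast
      then have "g \<otimes>\<^bsub>G2\<^esub> inv\<^bsub>G2\<^esub> s z \<in> kernel G2 G3 c"
        using g by (simp add: kernel_def cs)
      then obtain h where h: "h \<in> carrier G1" "e h = g \<otimes>\<^bsub>G2\<^esub> inv\<^bsub>G2\<^esub> s z"
        unfolding exact [symmetric] by auto
      then obtain x where x: "x \<in> carrier (Zpow n1)" "h = p1 x"
        using p1(2) by blast
      have "q (x, z) = g"
        using h x z g by (simp add: q_def G2.m_assoc)
      then show "g \<in> q ` carrier (Zpow n1 \<times>\<times> Zpow n3)"
        using x z by force
    qed
  qed (auto simp: q_def)
  show "kernel (Zpow n1 \<times>\<times> Zpow n3) G2 q = M ` carrier (Zpow n1' \<times>\<times> Zpow n3')"
  proof
    show "M ` carrier (Zpow n1' \<times>\<times> Zpow n3') \<subseteq> kernel (Zpow n1 \<times>\<times> Zpow n3) G2 q"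
      by (auto simp: M_def block_hom_apply kernel_def A_in Y_in B_in q_def p1_add pA eY)
    show "kernel (Zpow n1 \<times>\<times> Zpow n3) G2 q \<subseteq> M ` carrier (Zpow n1' \<times>\<times> Zpow n3')"
    proof
      fix w assume w: "w \<in> kernel (Zpow n1 \<times>\<times> Zpow n3) G2 q"
      obtain a b where ab: "w = (a, b)"
        by (cases w)
      have a: "a \<in> carrier (Zpow n1)" and b: "b \<in> carrier (Zpow n3)" and q1: "e (p1 a) \<otimes>\<^bsub>G2\<^esub> s b = \<one>\<^bsub>G2\<^esub>"
        using w by (auto simp: ab kernel_def q_def)
      have "c (e (p1 a) \<otimes>\<^bsub>G2\<^esub> s b) = p3 b"
        using a b by (simp add: ce cs)
      then have "b \<in> kernel (Zpow n3) G3 p3"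
        using b q1 by (simp add: kernel_def)
      \<comment> \<open>Clear the second coordinate by \<open>y\<close>, then the part of the first one in \<open>ker e\<close> by \<open>k \<in> ker B\<close>;
        the rest is a relation of \<open>G1\<close>, hence in the image of \<open>A\<close>.\<close>
      then obtain y where y: "y \<in> carrier (Zpow n3')" "b = mat_hom B y"
        unfolding p3(3) by blast
      have Yy: "mat_hom Y y \<in> carrier (Zpow n1)"
        using y Y_in by blast
      have sb: "s b \<in> carrier G2" "e (p1 (mat_hom Y y)) \<in> carrier G2" "e (p1 a) \<in> carrier G2"
        using a b Yy by simp_all
      have "e (p1 a) = e (p1 (mat_hom Y y))"
        using q1 eY [OF y(1)] sb unfolding y(2) by (metis G2.right_cancel)
      then have "p1 (a - mat_hom Y y) \<in> kernel G1 G2 e"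
        using a Yy by (simp add: kernel_def p1_diff)
      then obtain k where k: "k \<in> kernel (Zpow n3') (Zpow n3) (mat_hom B)" "p1 (a - mat_hom Y y) = p1 (mat_hom Y k)"
        using ker_e by blast
      have Yk: "k \<in> carrier (Zpow n3')" "mat_hom B k = 0" "mat_hom Y k \<in> carrier (Zpow n1)"
        using k(1) Y_in by (simp_all add: kernel_Zpow_iff)
      have "p1 (a - mat_hom Y y - mat_hom Y k) = \<one>\<^bsub>G1\<^esub>"
        using a Yy Yk k(2) p1_diff [of "a - mat_hom Y y" "mat_hom Y k"] by simp
      then have "a - mat_hom Y y - mat_hom Y k \<in> kernel (Zpow n1) G1 p1"
        using a Yy Yk by (simp add: kernel_def)
      then obtain x where x: "x \<in> carrier (Zpow n1')" "a - mat_hom Y y - mat_hom Y k = mat_hom A x"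
        unfolding p1(3) by blast
      have "w = M (x, y + k)"
        using x(2) by (simp add: ab M_def block_hom_apply y(2) Yk(2) algebra_simps)
      then show "w \<in> M ` carrier (Zpow n1' \<times>\<times> Zpow n3')"
        using x(1) y(1) Yk(1) by auto
    qed
  qed
qed

section \<open>Realisation of six-term exact sequences\<close>

theorem proposition4p3:
  fixes G1 :: "'g1 monoid" and G2 :: "'g2 monoid" and G3 :: "'g3 monoid"
    and F1 :: "'f1 monoid" and F2 :: "'f2 monoid" and F3 :: "'f3 monoid"
    and \<epsilon> :: "'g1 \<Rightarrow> 'g2" and \<gamma> :: "'g2 \<Rightarrow> 'g3"
    and \<epsilon>' :: "'f1 \<Rightarrow> 'f2" and \<gamma>' :: "'f2 \<Rightarrow> 'f3" and \<delta> :: "'f3 \<Rightarrow> 'g1"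
    and n1 n1' n3 n3' :: enat
    and A B :: "nat \<Rightarrow> nat \<Rightarrow> int"
    and \<alpha>1 :: "(nat \<Rightarrow>\<^sub>0 int) set \<Rightarrow> 'g1" and \<beta>1 :: "(nat \<Rightarrow>\<^sub>0 int) \<Rightarrow> 'f1"
    and \<alpha>3 :: "(nat \<Rightarrow>\<^sub>0 int) set \<Rightarrow> 'g3" and \<beta>3 :: "(nat \<Rightarrow>\<^sub>0 int) \<Rightarrow> 'f3"
  defines "\<E> \<equiv> SixTerm G1 \<epsilon> G2 \<gamma> G3 (\<lambda>_. \<one>\<^bsub>F1\<^esub>) F1 \<epsilon>' F2 \<gamma>' F3 \<delta>"
  assumes "exact_six_term \<E>"
    and "free_abelian F1" and "free_abelian F2" and "free_abelian F3"
    and "A \<in> col_finite_mats n1 n1'" and "B \<in> col_finite_mats n3 n3'"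
    and "\<alpha>1 \<in> iso (mat_coker n1 n1' A) G1" and "\<beta>1 \<in> iso (mat_ker n1 n1' A) F1"
    and "\<alpha>3 \<in> iso (mat_coker n3 n3' B) G3" and "\<beta>3 \<in> iso (mat_ker n3 n3' B) F3"
  shows "\<exists>Y \<in> col_finite_mats n1 n3'. \<exists>\<alpha>2 \<beta>2.
           exact_six_term (block_six_term n1 n1' n3 n3' A Y B) \<and>
           six_term_iso (block_six_term n1 n1' n3 n3' A Y B) \<E> \<alpha>1 \<alpha>2 \<alpha>3 \<beta>1 \<beta>2 \<beta>3"
proof -
  note E = assms(2) [unfolded \<E>_def exact_six_term.simps]
  have G1: "comm_group G1" and G2: "comm_group G2" and G3: "comm_group G3"
    and F1: "comm_group F1" and F2: "comm_group F2" and F3: "comm_group F3"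
    and e: "\<epsilon> \<in> hom G1 G2" and c: "\<gamma> \<in> hom G2 G3" and e': "\<epsilon>' \<in> hom F1 F2"
    and c': "\<gamma>' \<in> hom F2 F3" and d: "\<delta> \<in> hom F3 G1"
    using E by simp_all
  have ex2: "\<epsilon> ` carrier G1 = kernel G2 G3 \<gamma>"
    and ex3: "\<gamma> ` carrier G2 = kernel G3 F1 (\<lambda>_. \<one>\<^bsub>F1\<^esub>)"
    and ex4: "(\<lambda>_. \<one>\<^bsub>F1\<^esub>) ` carrier G3 = kernel F1 F2 \<epsilon>'"
    and ex5: "\<epsilon>' ` carrier F1 = kernel F2 F3 \<gamma>'"
    and ex6: "\<gamma>' ` carrier F2 = kernel F3 G1 \<delta>"
    and ex1: "\<delta> ` carrier F3 = kernel G1 G2 \<epsilon>"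
    using E by simp_all
  note A = assms(6) and B = assms(7) and a1 = assms(8) and b1 = assms(9) and a3 = assms(10) and b3 = assms(11)
  interpret G1: comm_group G1 by (rule G1)
  interpret G2: comm_group G2 by (rule G2)
  interpret G3: comm_group G3 by (rule G3)
  interpret F1: comm_group F1 by (rule F1)
  interpret e: group_hom G1 G2 \<epsilon> by (rule group_homI [OF G1 G2 e])
  interpret c: group_hom G2 G3 \<gamma> by (rule group_homI [OF G2 G3 c])
  interpret e': group_hom F1 F2 \<epsilon>' by (rule group_homI [OF F1 F2 e'])
  interpret d: group_hom F3 G1 \<delta> by (rule group_homI [OF F3 G1 d])
  have hA: "group_hom (Zpow n1') (Zpow n1) (mat_hom A)" and hB: "group_hom (Zpow n3') (Zpow n3) (mat_hom B)"
    by (simp_all add: group_homI mat_hom_hom A B)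
  note B_in = hom_in_carrier [OF mat_hom_hom [OF B]]
  let ?kA = "kernel (Zpow n1') (Zpow n1) (mat_hom A)" and ?kB = "kernel (Zpow n3') (Zpow n3) (mat_hom B)"
  have c_surj: "\<gamma> ` carrier G2 = carrier G3"
    unfolding ex3 by (simp add: kernel_def)
  have ce: "\<gamma> (\<epsilon> g) = \<one>\<^bsub>G3\<^esub>" if "g \<in> carrier G1" for g
    using ex2 that by (auto simp: kernel_def)
  have ed: "\<epsilon> (\<delta> f) = \<one>\<^bsub>G2\<^esub>" if "f \<in> carrier F3" for f
    using ex1 that by (auto simp: kernel_def)
  \<comment> \<open>Exactness at \<open>F1\<close>, where the incoming map is constant.\<close>
  have inj_e': "inj_on \<epsilon>' (carrier F1)"
    unfolding e'.inj_iff_trivial_ker ex4 [symmetric] using G3.one_closed by blast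
  define p1 where "p1 = \<alpha>1 \<circ> mat_coker_proj n1 n1' A"
  define p3 where "p3 = \<alpha>3 \<circ> mat_coker_proj n3 n3' B"
  have p1: "p1 \<in> hom (Zpow n1) G1" "p1 ` carrier (Zpow n1) = carrier G1"
      "kernel (Zpow n1) G1 p1 = mat_hom A ` carrier (Zpow n1')"
    unfolding p1_def by (rule hom_to_coker_kernel [OF hA comm_group_Zpow a1 G1.is_group])+
  have p3: "p3 \<in> hom (Zpow n3) G3" "p3 ` carrier (Zpow n3) = carrier G3"
      "kernel (Zpow n3) G3 p3 = mat_hom B ` carrier (Zpow n3')"
    unfolding p3_def by (rule hom_to_coker_kernel [OF hB comm_group_Zpow a3 G3.is_group])+
  have pB: "p3 (mat_hom B y) = \<one>\<^bsub>G3\<^esub>" if "y \<in> carrier (Zpow n3')" for y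
    using p3(3) that by (auto simp: kernel_def)
  obtain s where s: "s \<in> hom (Zpow n3) G2" and cs: "\<And>x. x \<in> carrier (Zpow n3) \<Longrightarrow> \<gamma> (s x) = p3 x"
    using Zpow_lift [OF G2 G3.is_group c p3(1)] p3(2) c_surj by blast
  interpret s: group_hom "Zpow n3" G2 s by (rule group_homI [OF comm_group_Zpow G2 s])
  have s0: "s 0 = \<one>\<^bsub>G2\<^esub>"
    using s.hom_one by simp
  have s_add: "s (x + y) = s x \<otimes>\<^bsub>G2\<^esub> s y" if "x \<in> carrier (Zpow n3)" "y \<in> carrier (Zpow n3)" for x y
    using s.hom_mult [OF that] by simp
  \<comment> \<open>The defect of \<open>s\<close> on the relations of \<open>G3\<close>, which \<open>Y\<close> has to compensate.\<close>
  define w where "w y = inv\<^bsub>G2\<^esub> s (mat_hom B y)" for y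
  have w: "w \<in> hom (Zpow n3') G2"
    by (rule homI) (simp_all add: w_def B_in s_add G2.inv_mult)
  have w_im: "w ` carrier (Zpow n3') \<subseteq> \<epsilon> ` carrier G1"
    unfolding ex2 by (auto simp: kernel_def w_def B_in cs pB)
  have dB: "\<delta> \<circ> \<beta>3 \<in> hom (mat_ker n3 n3' B) G1"
    using b3 d by (auto simp: iso_def intro: hom_compose)
  have b3_im: "\<beta>3 ` ?kB = carrier F3"
    using iso_image [OF b3] by simp
  have b3_in: "\<beta>3 y \<in> carrier F3" if "y \<in> ?kB" for y
    using b3_im that by blast
  have edw: "\<epsilon> ((\<delta> \<circ> \<beta>3) y) = w y" if "y \<in> ?kB" for y
    using that ed [OF b3_in [OF that]] by (simp add: w_def kernel_Zpow_iff s0)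
  \<comment> \<open>On \<open>ker B\<close> the two requirements on \<open>u\<close> are compatible: there \<open>w\<close> is trivial, and so is \<open>\<epsilon> \<circ> \<delta>\<close>.\<close>
  obtain u where u: "u \<in> hom (Zpow n3') G1" and eu: "\<And>y. y \<in> carrier (Zpow n3') \<Longrightarrow> \<epsilon> (u y) = w y"
    and ud: "\<And>y. y \<in> ?kB \<Longrightarrow> u y = \<delta> (\<beta>3 y)"
    using hom_Zpow_extend_lift [OF G1 G2 e w w_im mat_hom_hom [OF B] dB edw] by (metis comp_apply)
  have u_im: "u ` carrier (Zpow n3') \<subseteq> p1 ` carrier (Zpow n1)"
    using hom_in_carrier [OF u] p1(2) by blast
  obtain y0 where y0: "y0 \<in> hom (Zpow n3') (Zpow n1)" and p1y0: "\<And>y. y \<in> carrier (Zpow n3') \<Longrightarrow> p1 (y0 y) = u y"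
    using Zpow_lift [OF comm_group_Zpow G1.is_group p1(1) u u_im] by blast
  obtain Y where Y: "Y \<in> col_finite_mats n1 n3'" and Yy0: "\<And>y. y \<in> carrier (Zpow n3') \<Longrightarrow> mat_hom Y y = y0 y"
    using hom_Zpow_matrix [OF y0] by blast
  have pY: "p1 (mat_hom Y y) = u y" if "y \<in> carrier (Zpow n3')" for y
    using p1y0 Yy0 that by simp
  have pYd: "p1 (mat_hom Y y) = \<delta> (\<beta>3 y)" if "y \<in> ?kB" for y
    using pY [of y] ud [OF that] that by (simp add: kernel_Zpow_iff)
  note Y_in = hom_in_carrier [OF mat_hom_hom [OF Y]]
  let ?D = "Zpow n1' \<times>\<times> Zpow n3'" and ?R = "Zpow n1 \<times>\<times> Zpow n3" and ?M = "block_hom A Y (\<lambda>_ _. 0) B"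
  have hM: "group_hom ?D ?R ?M"
    by (simp add: group_homI block_hom_hom A B Y)
  have eY: "\<epsilon> (p1 (mat_hom Y y)) \<otimes>\<^bsub>G2\<^esub> s (mat_hom B y) = \<one>\<^bsub>G2\<^esub>" if "y \<in> carrier (Zpow n3')" for y
    using that by (simp add: pY eu w_def B_in)
  have ker_e: "kernel G1 G2 \<epsilon> \<subseteq> (\<lambda>y. p1 (mat_hom Y y)) ` ?kB"
    unfolding ex1 [symmetric] b3_im [symmetric] using pYd by force
  define q where "q = (\<lambda>(x, z). \<epsilon> (p1 x) \<otimes>\<^bsub>G2\<^esub> s z)"
  note q = block_coker_presentation [OF A Y B G1 G2 G3 e c ex2 p1 p3 s cs eY ker_e, folded q_def]
  have hq: "group_hom ?R G2 q"
    by (rule group_homI [OF comm_group_Zpow_prod G2 q(1)])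
  define \<alpha>2 where "\<alpha>2 X = the_elem (q ` X)" for X
  have a2: "\<alpha>2 \<in> iso (coker_group ?D ?R ?M) G2"
    unfolding \<alpha>2_def by (rule coker_iso_of_presentation(1) [OF hq q(2,3)])
  have a2_proj: "\<alpha>2 (coker_proj ?D ?R ?M x) = q x" if "x \<in> carrier ?R" for x
    unfolding \<alpha>2_def by (rule coker_iso_of_presentation(2) [OF hq q(2,3) that])
  \<comment> \<open>By exactness at \<open>F3\<close>, both sides say that \<open>\<delta> (\<beta>3 y)\<close> is trivial.\<close>
  have range: "\<beta>3 y \<in> \<gamma>' ` carrier F2 \<longleftrightarrow> mat_hom Y y \<in> mat_hom A ` carrier (Zpow n1')" if y: "y \<in> ?kB" for y
  proof -
    have "mat_hom Y y \<in> carrier (Zpow n1)"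
      using y Y_in by (simp add: kernel_Zpow_iff)
    then show ?thesis
      unfolding ex6 p1(3) [symmetric] using b3_in [OF y] pYd [OF y] by (simp add: kernel_def)
  qed
  obtain \<beta>2 where b2: "\<beta>2 \<in> iso (ker_group ?D ?R ?M) F2"
    and b2_incl: "\<And>x. x \<in> ?kA \<Longrightarrow> \<beta>2 (x, 0) = \<epsilon>' (\<beta>1 x)"
    and b2_proj: "\<And>z. z \<in> kernel ?D ?R ?M \<Longrightarrow> \<gamma>' (\<beta>2 z) = \<beta>3 (snd z)"
    using block_kernel_iso [OF A Y B F1 F2 F3 e' inj_e' c' ex5 b1 b3 range, simplified ker_group_simps(1)] by blast
  have incl_hom: "(\<lambda>x. (x, 0)) \<in> hom (Zpow n1) ?R"
    by (rule homI) auto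
  have snd_hom: "snd \<in> hom ?R (Zpow n3)"
    by (rule homI) auto
  have incl_im: "(\<lambda>x. (x, 0)) ` mat_hom A ` carrier (Zpow n1') \<subseteq> ?M ` carrier ?D"
  proof clarify
    fix x assume "x \<in> carrier (Zpow n1')"
    then have "(x, 0) \<in> carrier ?D" and "(mat_hom A x, 0) = ?M (x, 0)"
      by (simp_all add: block_hom_apply)
    then show "(mat_hom A x, 0) \<in> ?M ` carrier ?D"
      by (metis image_eqI)
  qed
  have snd_im: "snd ` ?M ` carrier ?D \<subseteq> mat_hom B ` carrier (Zpow n3')"
    by (auto simp: block_hom_apply)
  note I = induced_map_coker_proj [OF hA hM comm_group_Zpow_prod incl_hom incl_im]
    and P = induced_map_coker_proj [OF hM hB comm_group_Zpow snd_hom snd_im]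
  have iso: "six_term_iso (block_six_term n1 n1' n3 n3' A Y B) \<E> \<alpha>1 \<alpha>2 \<alpha>3 \<beta>1 \<beta>2 \<beta>3"
    unfolding block_six_term_def Let_def \<E>_def six_term_iso.simps
  proof (intro conjI ballI a1 a2 a3 b1 b2 b3)
    fix X assume "X \<in> carrier (mat_coker n1 n1' A)"
    then obtain x where x: "x \<in> carrier (Zpow n1)" "X = mat_coker_proj n1 n1' A x"
      by (auto simp: carrier_coker_group)
    then have "\<alpha>2 (induced_map (coker_proj ?D ?R ?M) (\<lambda>x. (x, 0)) X) = \<epsilon> (p1 x)"
      using hom_in_carrier [OF p1(1) x(1)] by (simp add: I a2_proj q_def s0)
    then show "\<alpha>2 (induced_map (coker_proj ?D ?R ?M) (\<lambda>x. (x, 0)) X) = \<epsilon> (\<alpha>1 X)"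
      by (simp add: p1_def x(2))
  next
    fix X assume "X \<in> carrier (coker_group ?D ?R ?M)"
    then obtain x z where xz: "x \<in> carrier (Zpow n1)" "z \<in> carrier (Zpow n3)" "X = coker_proj ?D ?R ?M (x, z)"
      by (auto simp: carrier_coker_group)
    have "\<alpha>3 (induced_map (mat_coker_proj n3 n3' B) snd X) = p3 z"
      using xz by (simp add: P p3_def)
    also have "\<dots> = \<gamma> (q (x, z))"
      using xz hom_in_carrier [OF p1(1)] by (simp add: q_def ce cs hom_in_carrier [OF p3(1)])
    also have "q (x, z) = \<alpha>2 X"
      using xz by (simp add: a2_proj)
    finally show "\<alpha>3 (induced_map (mat_coker_proj n3 n3' B) snd X) = \<gamma> (\<alpha>2 X)" .
  next
    show "\<beta>1 0 = \<one>\<^bsub>F1\<^esub>"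
      using hom_one [of \<beta>1 "mat_ker n1 n1' A" F1] b1 F1.is_group
        comm_group.axioms(2) [OF comm_group_ker_group [OF comm_group_Zpow hA]]
      by (simp add: iso_def)
  next
    fix x assume "x \<in> carrier (mat_ker n1 n1' A)"
    then show "\<beta>2 (x, 0) = \<epsilon>' (\<beta>1 x)"
      by (simp add: b2_incl)
  next
    fix z assume "z \<in> carrier (ker_group ?D ?R ?M)"
    then show "\<beta>3 (snd z) = \<gamma>' (\<beta>2 z)"
      by (simp add: b2_proj)
  next
    fix y assume "y \<in> carrier (mat_ker n3 n3' B)"
    then show "\<alpha>1 (mat_coker_proj n1 n1' A (mat_hom Y y)) = \<delta> (\<beta>3 y)"
      using pYd [of y] by (simp add: p1_def)
  qed
  have "exact_six_term (block_six_term n1 n1' n3 n3' A Y B)"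
    unfolding block_six_term_def Let_def
  proof (rule exact_six_term_transport [OF iso [unfolded block_six_term_def Let_def \<E>_def]])
    show "exact_six_term (SixTerm G1 \<epsilon> G2 \<gamma> G3 (\<lambda>_. \<one>\<^bsub>F1\<^esub>) F1 \<epsilon>' F2 \<gamma>' F3 \<delta>)"
      using assms(2) by (simp only: \<E>_def)
    show "induced_map (coker_proj ?D ?R ?M) (\<lambda>x. (x, 0)) \<in>
        carrier (mat_coker n1 n1' A) \<rightarrow> carrier (coker_group ?D ?R ?M)"
      by (auto simp: carrier_coker_group I)
    show "induced_map (mat_coker_proj n3 n3' B) snd \<in>
        carrier (coker_group ?D ?R ?M) \<rightarrow> carrier (mat_coker n3 n3' B)"
      by (auto simp: carrier_coker_group P)
    show "(\<lambda>y. mat_coker_proj n1 n1' A (mat_hom Y y)) \<in> carrier (mat_ker n3 n3' B) \<rightarrow> carrier (mat_coker n1 n1' A)"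
      using Y_in by (auto simp: carrier_coker_group kernel_Zpow_iff)
  qed (use comm_group_coker_group [OF hA] comm_group_coker_group [OF hB] comm_group_coker_group [OF hM]
      comm_group_ker_group [OF _ hA] comm_group_ker_group [OF _ hB] comm_group_ker_group [OF _ hM]
      in \<open>auto simp: kernel_Zpow_iff block_kernel_iff\<close>)
  with iso Y show ?thesis
    by blast
qed

end
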